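(* There is an absolute constant $C>0$ such that for all integers $n\geq 2$ and $r$ with $\sqrt{n\log n}\leq r<n$, \[ \left|\kappa(n,r)-\mathrm{e}^{-H_r+\gamma}\,\omega(n/r)\right|\leq C\,\frac{\varrho(n/r)}{r^2}. \] (That is, $\kappa(n,r)=\mathrm{e}^{-H_r+\gamma}\omega(n/r)+O\bigl(\varrho(n/r)/r^2\bigr)$ uniformly in this range.)
   Context: For integers $1\leq r<n$, $\kappa(n,r)$ denotes the probability that a permutation chosen uniformly at random from the symmetric group $\mathrm{S}_n$ has no cycles of length less than $r+1$ (i.e. all its cycles have length $>r$). $H_r=\sum_{j=1}^r 1/j$ is the $r$-th harmonic number and $\gamma$ is Euler's constant. Buchstab's function $\omega(v)$, $v\geq 1$, is defined by $\omega(v)=1/v$ for $1\leq v\leq 2$ and, for $v>2$, as the continuous solution of $(v\omega(v))'=\omega(v-1)$. Dickman's function $\varrho(v)$, $v\geq 0$, is the unique continuous function with $\varrho(v)=1$ for $0\leq v\leq 1$ and $v\varrho'(v)+\varrho(v-1)=0$ for $v>1$. *)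

theory Defs
  imports "HOL-Probability.Probability" "HOL-Combinatorics.Orbits"
begin

text \<open>
  Permutations of \<open>{1..n}\<close> are functions \<^typ>\<open>nat \<Rightarrow> nat\<close> fixing everything outside
  \<open>{1..n}\<close>; the cycles of \<open>p\<close> are its orbits on \<open>{1..n}\<close>, so that a fixed point counts as
  a cycle of length 1.
\<close>

definition perm_cycles :: "nat \<Rightarrow> (nat \<Rightarrow> nat) \<Rightarrow> nat set set" where
  "perm_cycles n p = orbit p ` {1..n}"

definition kappa :: "nat \<Rightarrow> nat \<Rightarrow> real" where
  "kappa n r =
     measure_pmf.prob (pmf_of_set {p. p permutes {1..n}}) {p. \<forall>c\<in>perm_cycles n p. r < card c}"

definition is_buchstab :: "(real \<Rightarrow> real) \<Rightarrow> bool" where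
  "is_buchstab w \<longleftrightarrow>
     continuous_on {1..} w \<and>
     (\<forall>v. 1 \<le> v \<and> v \<le> 2 \<longrightarrow> w v = 1 / v) \<and>
     (\<forall>v>2. ((\<lambda>u. u * w u) has_real_derivative w (v - 1)) (at v))"

definition is_dickman :: "(real \<Rightarrow> real) \<Rightarrow> bool" where
  "is_dickman q \<longleftrightarrow>
     continuous_on {0..} q \<and>
     (\<forall>v. 0 \<le> v \<and> v \<le> 1 \<longrightarrow> q v = 1) \<and>
     (\<forall>v>1. q differentiable (at v) \<and> v * deriv q v + q (v - 1) = 0)"

text \<open>
  The two functions are normalised to be 0 to the left of their domains; this makes the
  descriptions below unique. Existence and uniqueness are \<open>ex1_buchstab\<close> and
  \<open>ex1_dickman\<close>.
\<close>

definition buchstab :: "real \<Rightarrow> real" where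
  "buchstab = (THE w. is_buchstab w \<and> (\<forall>v<1. w v = 0))"

definition dickman :: "real \<Rightarrow> real" where
  "dickman = (THE q. is_dickman q \<and> (\<forall>v<0. q v = 0))"

lemma antiderivative_ex:
  fixes h :: "real \<Rightarrow> real"
  assumes "continuous_on UNIV h"
  shows "\<exists>F. \<forall>x. (F has_real_derivative h x) (at x)"
  using einterval_antiderivative[of "-\<infinity>" "\<infinity>" h] assms
  by (auto simp: continuous_on_eq_continuous_at has_real_derivative_iff_has_vector_derivative)

primrec delay_iter :: "(real \<Rightarrow> real) \<Rightarrow> real \<Rightarrow> nat \<Rightarrow> real \<Rightarrow> real" where
  "delay_iter K a 0 = (\<lambda>_. 1)"
| "delay_iter K a (Suc n) =
     (let F = (SOME F. \<forall>x. (F has_real_derivative K (max a x) * delay_iter K a n (x - 1)) (at x))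
      in (\<lambda>x. 1 + F (max a x) - F a))"

lemma delay_iter_props:
  assumes K: "continuous_on {a..} K"
  shows "continuous_on UNIV (delay_iter K a n)"
    and "x \<le> a \<Longrightarrow> delay_iter K a n x = 1"
    and "x > a \<Longrightarrow>
      (delay_iter K a (Suc n) has_real_derivative K x * delay_iter K a n (x - 1)) (at x)"
proof -
  define F where "F n = (SOME F. \<forall>x. (F has_real_derivative
      K (max a x) * delay_iter K a n (x - 1)) (at x))" for n
  have Suc_eq: "delay_iter K a (Suc n) = (\<lambda>x. 1 + F n (max a x) - F n a)" for n
    by (simp add: F_def Let_def)
  have K': "continuous_on UNIV (\<lambda>x. K (max a x))"
    by (rule continuous_on_compose2[OF K]) (auto intro!: continuous_intros)
  have F: "(F n has_real_derivative K (max a x) * delay_iter K a n (x - 1)) (at x)"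
    if "continuous_on UNIV (delay_iter K a n)" for n x
  proof -
    have "continuous_on UNIV (\<lambda>x. delay_iter K a n (x - 1))"
      by (rule continuous_on_compose2[OF that]) (auto intro!: continuous_intros)
    hence "continuous_on UNIV (\<lambda>x. K (max a x) * delay_iter K a n (x - 1))"
      by (intro continuous_on_mult K')
    from someI_ex[OF antiderivative_ex[OF this]] show ?thesis
      unfolding F_def by blast
  qed
  have cont: "continuous_on UNIV (delay_iter K a n)" for n
  proof (induction n)
    case (Suc n)
    have "continuous_on UNIV (F n)"
      using F[OF Suc] DERIV_isCont continuous_at_imp_continuous_on by blast
    hence "continuous_on UNIV (\<lambda>x. F n (max a x))"
      by (rule continuous_on_compose2) (auto intro!: continuous_intros)
    thus ?case unfolding Suc_eq by (intro continuous_intros)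
  qed simp
  show "continuous_on UNIV (delay_iter K a n)" by (rule cont)
  show "delay_iter K a n x = 1" if "x \<le> a"
    using that by (cases n) (simp_all add: Suc_eq max_def del: delay_iter.simps(2))
  show "(delay_iter K a (Suc n) has_real_derivative K x * delay_iter K a n (x - 1)) (at x)"
    if x: "x > a"
  proof -
    have "((\<lambda>x. 1 + F n x - F n a) has_real_derivative K x * delay_iter K a n (x - 1)) (at x)"
      using F[OF cont, of n x] x by (auto intro!: derivative_eq_intros simp: max_def)
    thus ?thesis
    proof (rule has_field_derivative_transform_within_open)
      show "open {a<..}" "x \<in> {a<..}" using x by auto
    qed (simp add: Suc_eq max_def del: delay_iter.simps(2))
  qed
qed

lemma delay_unique:
  fixes f g :: "real \<Rightarrow> real"
  assumes f: "continuous_on {a-1..} f" "\<And>x. x > a \<Longrightarrow> (f has_real_derivative K x * f (x - 1)) (at x)"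
    and g: "continuous_on {a-1..} g" "\<And>x. x > a \<Longrightarrow> (g has_real_derivative K x * g (x - 1)) (at x)"
    and eq: "\<And>x. a - 1 \<le> x \<Longrightarrow> x \<le> a \<Longrightarrow> f x = g x"
    and "a - 1 \<le> x"
  shows "f x = g x"
proof -
  have "\<forall>x. a - 1 \<le> x \<and> x \<le> a + real n \<longrightarrow> f x = g x" for n
  proof (induction n)
    case (Suc n)
    show ?case
    proof (intro allI impI)
      fix x assume x: "a - 1 \<le> x \<and> x \<le> a + real (Suc n)"
      show "f x = g x"
      proof (cases "x \<le> a")
        case False
        have "(\<lambda>y. f y - g y) x = (\<lambda>y. f y - g y) a"
        proof (rule DERIV_isconst2[of a x])
          show "continuous_on {a..x} (\<lambda>y. f y - g y)"
            by (intro continuous_intros continuous_on_subset[OF f(1)]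
                  continuous_on_subset[OF g(1)]) auto
          fix y assume y: "a < y" "y < x"
          have "f (y - 1) = g (y - 1)" using Suc y x by auto
          thus "((\<lambda>y. f y - g y) has_real_derivative 0) (at y)"
            using DERIV_diff[OF f(2)[OF y(1)] g(2)[OF y(1)]] by simp
        qed (use False in auto)
        thus ?thesis using eq[of a] by simp
      qed (use eq x in auto)
    qed
  qed (use eq in auto)
  moreover have "x \<le> a + real (nat \<lceil>x - a\<rceil>)" by linarith
  ultimately show ?thesis using assms(6) by blast
qed

lemma delay_ex:
  assumes K: "continuous_on {a..} K"
  obtains f :: "real \<Rightarrow> real" where "continuous_on UNIV f" "\<And>x. x \<le> a \<Longrightarrow> f x = 1"
    "\<And>x. x > a \<Longrightarrow> (f has_real_derivative K x * f (x - 1)) (at x)"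
proof -
  let ?S = "delay_iter K a"
  note P = delay_iter_props[OF K]
  have step: "\<forall>x. x \<le> a + real n \<longrightarrow> ?S (Suc n) x = ?S n x" for n
  proof (induction n)
    case 0
    show ?case using P(2) by (simp del: delay_iter.simps)
  next
    case (Suc n)
    show ?case
    proof (intro allI impI)
      fix x assume x: "x \<le> a + real (Suc n)"
      let ?d = "\<lambda>y. ?S (Suc (Suc n)) y - ?S (Suc n) y"
      show "?S (Suc (Suc n)) x = ?S (Suc n) x"
      proof (cases "x \<le> a")
        case False
        have "?d x = ?d a"
        proof (rule DERIV_isconst2[of a x])
          show "continuous_on {a..x} ?d"
            by (intro continuous_intros continuous_on_subset[OF P(1)]) auto
          fix y assume y: "a < y" "y < x"
          have "?S (Suc n) (y - 1) = ?S n (y - 1)" using Suc y x by auto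
          thus "(?d has_real_derivative 0) (at y)"
            using DERIV_diff[OF P(3)[OF y(1), of "Suc n"] P(3)[OF y(1), of n]]
            by (simp del: delay_iter.simps)
        qed (use False in auto)
        thus ?thesis by (simp add: P(2) del: delay_iter.simps)
      qed (simp add: P(2) del: delay_iter.simps)
    qed
  qed
  have stable: "?S m x = ?S n x" if "n \<le> m" "x \<le> a + real n" for m n x
    using that
  proof (induction rule: dec_induct)
    case (step k)
    thus ?case using \<open>\<forall>x. x \<le> a + real k \<longrightarrow> ?S (Suc k) x = ?S k x\<close>
      by (simp del: delay_iter.simps)
  qed simp
  define f where "f x = ?S (nat \<lceil>x - a\<rceil>) x" for x
  have f: "f x = ?S m x" if "x \<le> a + real m" for m x
  proof -
    have "x \<le> a + real (nat \<lceil>x - a\<rceil>)" by linarith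
    with that stable[of m "nat \<lceil>x - a\<rceil>" x] stable[of "nat \<lceil>x - a\<rceil>" m x] show ?thesis
      unfolding f_def by (cases "m \<le> nat \<lceil>x - a\<rceil>") auto
  qed
  have ex: "\<exists>m. x < a + real m" for x
    using reals_Archimedean2[of "x - a"] by (auto simp: algebra_simps)
  show thesis
  proof
    have "isCont f x" for x
    proof -
      obtain m where m: "x < a + real m" using ex by blast
      have "\<forall>\<^sub>F y in nhds x. y < a + real m"
        using m by (intro eventually_nhds_in_open[of "{..<a + real m}" x, simplified])
      hence "\<forall>\<^sub>F y in nhds x. f y = ?S m y" by eventually_elim (simp add: f)
      thus ?thesis
        using P(1)[of m] by (simp add: continuous_on_eq_continuous_at isCont_cong)
    qed
    thus "continuous_on UNIV f" by (simp add: continuous_on_eq_continuous_at)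
    show "f x = 1" if "x \<le> a" for x using that by (simp add: f_def P(2))
    show "(f has_real_derivative K x * f (x - 1)) (at x)" if x: "x > a" for x
    proof -
      obtain m where m: "x < a + real m" using ex by blast
      have "f (x - 1) = ?S m (x - 1)" using m by (intro f) auto
      with P(3)[OF x, of m]
      have "(?S (Suc m) has_real_derivative K x * f (x - 1)) (at x)" by simp
      thus ?thesis
      proof (rule has_field_derivative_transform_within_open)
        show "open {..<a + real m}" "x \<in> {..<a + real m}" using m by auto
        show "?S (Suc m) y = f y" if "y \<in> {..<a + real m}" for y
          using that by (intro f[symmetric]) auto
      qed
    qed
  qed
qed

lemma ex1_buchstab: "\<exists>!w. is_buchstab w \<and> (\<forall>v<1. w v = 0)"
proof (rule ex_ex1I)
  let ?K = "\<lambda>t::real. 1 / (t - 1)"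
  have "continuous_on {2..} ?K" by (auto intro!: continuous_intros)
  then obtain f where f: "continuous_on UNIV f" "\<And>x. x \<le> 2 \<Longrightarrow> f x = 1"
    "\<And>x. x > 2 \<Longrightarrow> (f has_real_derivative ?K x * f (x - 1)) (at x)"
    by (rule delay_ex) auto
  define w where "w v = (if v < 1 then 0 else f v / v)" for v
  have "continuous_on {1..} (\<lambda>v. f v / v)"
    using f(1) by (auto intro!: continuous_intros continuous_on_subset[OF f(1)])
  hence "continuous_on {1..} w"
    by (rule continuous_on_eq) (simp add: w_def)
  moreover have "((\<lambda>u. u * w u) has_real_derivative w (v - 1)) (at v)" if "v > 2" for v
  proof -
    have "(f has_real_derivative w (v - 1)) (at v)"
      using f(3)[OF that] that by (simp add: w_def)
    thus ?thesis
      by (rule has_field_derivative_transform_within_open[of _ _ _ "{2<..}"])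
        (use that in \<open>auto simp: w_def\<close>)
  qed
  ultimately show "\<exists>w. is_buchstab w \<and> (\<forall>v<1. w v = 0)"
    by (intro exI[of _ w]) (auto simp: is_buchstab_def f(2) w_def)
next
  fix w w' assume w: "is_buchstab w \<and> (\<forall>v<1. w v = 0)" and w': "is_buchstab w' \<and> (\<forall>v<1. w' v = 0)"
  have *: "continuous_on {2 - 1..} (\<lambda>v. v * w v)"
      "\<And>x. x > 2 \<Longrightarrow> ((\<lambda>v. v * w v) has_real_derivative 1 / (x - 1) * ((x - 1) * w (x - 1))) (at x)"
    if "is_buchstab w \<and> (\<forall>v<1. w v = 0)" for w
    using that by (auto simp: is_buchstab_def intro!: continuous_intros)
  show "w = w'"
  proof
    fix v :: real
    show "w v = w' v"
    proof (cases "v < 1")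
      case False
      have "v * w v = v * w' v"
        by (rule delay_unique[where K = "\<lambda>x. 1 / (x - 1)", OF *[OF w] *[OF w']])
          (use w w' False in \<open>auto simp: is_buchstab_def\<close>)
      thus ?thesis using False by simp
    qed (use w w' in auto)
  qed
qed

lemma ex1_dickman: "\<exists>!q. is_dickman q \<and> (\<forall>v<0. q v = 0)"
proof (rule ex_ex1I)
  let ?K = "\<lambda>t::real. - 1 / t"
  have "continuous_on {1..} ?K" by (auto intro!: continuous_intros)
  then obtain f where f: "continuous_on UNIV f" "\<And>x. x \<le> 1 \<Longrightarrow> f x = 1"
    "\<And>x. x > 1 \<Longrightarrow> (f has_real_derivative ?K x * f (x - 1)) (at x)"
    by (rule delay_ex) auto
  define q where "q v = (if v < 0 then 0 else f v)" for v
  have "continuous_on {0..} q"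
    by (rule continuous_on_eq[OF continuous_on_subset[OF f(1)]]) (auto simp: q_def)
  moreover have q': "(q has_real_derivative - q (v - 1) / v) (at v)" if "v > 1" for v
  proof -
    have "(f has_real_derivative - q (v - 1) / v) (at v)"
      using f(3)[OF that] that by (simp add: q_def)
    thus ?thesis
      by (rule has_field_derivative_transform_within_open[of _ _ _ "{1<..}"])
        (use that in \<open>auto simp: q_def\<close>)
  qed
  moreover have "q differentiable (at v) \<and> v * deriv q v + q (v - 1) = 0" if "v > 1" for v
    using q'[OF that] that DERIV_imp_deriv[OF q'[OF that]]
    by (auto simp: real_differentiable_def)
  ultimately show "\<exists>q. is_dickman q \<and> (\<forall>v<0. q v = 0)"
    by (intro exI[of _ q]) (auto simp: is_dickman_def f(2) q_def)
next
  fix q q' assume q: "is_dickman q \<and> (\<forall>v<0. q v = 0)" and q': "is_dickman q' \<and> (\<forall>v<0. q' v = 0)"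
  have *: "continuous_on {1 - 1..} q"
      "\<And>x. x > 1 \<Longrightarrow> (q has_real_derivative (- 1 / x) * q (x - 1)) (at x)"
    if "is_dickman q \<and> (\<forall>v<0. q v = 0)" for q
  proof -
    show "continuous_on {1 - 1..} q" using that by (simp add: is_dickman_def)
    fix x :: real assume x: "x > 1"
    have "q differentiable (at x)" and e: "x * deriv q x + q (x - 1) = 0"
      using that x by (auto simp: is_dickman_def)
    hence "(q has_real_derivative deriv q x) (at x)"
      using DERIV_imp_deriv by (fastforce simp: real_differentiable_def)
    moreover have "deriv q x = (- 1 / x) * q (x - 1)"
      using e x by (simp add: field_simps)
    ultimately show "(q has_real_derivative (- 1 / x) * q (x - 1)) (at x)" by simp
  qed
  show "q = q'"
  proof
    fix v :: real
    show "q v = q' v"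
    proof (cases "v < 0")
      case False
      show ?thesis
        by (rule delay_unique[where K = "\<lambda>x. - 1 / x", OF *[OF q] *[OF q']])
          (use q q' False in \<open>auto simp: is_dickman_def\<close>)
    qed (use q q' in auto)
  qed
qed

lemma is_buchstab_buchstab: "is_buchstab buchstab"
  and is_dickman_dickman: "is_dickman dickman"
  using theI'[OF ex1_buchstab] theI'[OF ex1_dickman]
  by (simp_all add: buchstab_def dickman_def)

end

theory Submission
  imports Defs "HOL-Real_Asymp.Real_Asymp"
begin

text \<open>
  Put \<open>k(n) = kappa n r\<close>, \<open>\<omega> = buchstab\<close>, \<open>\<rho> = dickman\<close> and \<open>d(n) = k(n) - e\<^sup>c \<omega>(n/r)\<close> with
  \<open>c = \<gamma> - H\<^sub>r\<close>. Splitting off the cycle through a fixed point gives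
  \<open>(n + 1) k(n + 1) = n k(n) + k(n - r)\<close>, the discrete form of \<open>(v \<omega>(v))' = \<omega>(v - 1)\<close>. Hence the
  differences \<open>D(m) = d(m + 1) - d(m)\<close> satisfy \<open>(m + 1) D(m) = - \<Sum>j\<in>{m-r..<m}. D(j)\<close> up to an error
  controlled by \<open>\<omega>'\<close> at \<open>(m - r)/r\<close>. As \<open>v \<rho>(v)\<close> is the integral of \<open>\<rho>\<close> over \<open>[v - 1, v]\<close>, the sequence
  \<open>\<rho>(m/(r + 1))\<close>, slightly tilted, is a supersolution of the recursion for \<open>\<bar>D\<bar>\<close>, and summing \<open>D\<close>
  over \<open>m \<ge> n\<close> bounds \<open>d(n) - d(\<infinity>)\<close> by \<open>\<rho>(n/(r + 1))/r\<^sup>2\<close>. In the range of the theorem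
  \<open>\<rho>(n/(r + 1))\<close> and \<open>\<rho>(n/r)\<close> are comparable, since \<open>-\<rho>'/\<rho>\<close> grows only logarithmically.
  Here \<open>d(\<infinity>) = e\<^sup>c (e\<^sup>-\<^sup>\<gamma> - \<omega>(\<infinity>))\<close>; letting \<open>r\<close> tend to infinity in the same bound shows \<open>\<omega>(\<infinity>) = e\<^sup>-\<^sup>\<gamma>\<close>.

  The argument needs more than \<open>\<omega>' = O(\<rho>)\<close>: the error has to be summable against \<open>\<rho>\<close>, and for this
  \<open>\<omega>'(v) = O(\<rho>(v)/v\<^sup>4)\<close> is proved. The gain comes from the oscillation of \<open>\<omega>'\<close>: \<open>v \<omega>'(v)\<close> is minus the
  integral of \<open>\<omega>'\<close> over \<open>[v - 1, v]\<close>, so mixing two and three iterations of this identity produces kernels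
  of opposite signs, whereas for \<open>\<rho>\<close> all the signs are positive.
\<close>

section \<open>Permutations without short cycles\<close>

definition long_cycle_perms :: "nat \<Rightarrow> 'a set \<Rightarrow> ('a \<Rightarrow> 'a) set" where
  "long_cycle_perms r S = {p. p permutes S \<and> (\<forall>x\<in>S. r < card (orbit p x))}"

definition full_cycles :: "'a set \<Rightarrow> 'a \<Rightarrow> ('a \<Rightarrow> 'a) set" where
  "full_cycles S a = {p. p permutes S \<and> orbit p a = S}"

lemma finite_long_cycle_perms: "finite S \<Longrightarrow> finite (long_cycle_perms r S)"
  unfolding long_cycle_perms_def
  by (rule finite_subset[OF _ finite_permutations[of S]]) auto

section \<open>Restrictions of a permutation to an orbit and to its complement\<close>

lemma permutes_orbit_self:
  assumes "p permutes S" "finite S"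
  shows "x \<in> orbit p x"
proof (rule permutation_self_in_orbit)
  show "permutation p" unfolding permutation_permutes using assms by blast
qed

lemma perm_restrict_orbit_permutes:
  assumes "p permutes S" "finite S" "a \<in> S"
  shows "perm_restrict p (orbit p a) permutes orbit p a"
proof (rule bij_imp_permutes)
  have fin: "finite (orbit p a)"
    by (rule finite_subset[OF permutes_orbit_subset[OF assms(1,3)] assms(2)])
  have "inj_on p (orbit p a)"
    by (rule inj_on_subset[OF permutes_inj[OF assms(1)]]) simp
  moreover have "p ` orbit p a \<subseteq> orbit p a" by (intro image_subsetI orbit.step)
  ultimately have "bij_betw p (orbit p a) (orbit p a)"
    using endo_inj_surj[OF fin] unfolding bij_betw_def by blast
  thus "bij_betw (perm_restrict p (orbit p a)) (orbit p a) (orbit p a)"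
    by (rule iffD2[OF bij_betw_cong, rotated]) (rule perm_restrict_simps)
qed (simp add: perm_restrict_def)

lemma orbit_perm_restrict:
  assumes "p permutes S" "finite S" "\<And>y. y \<in> orbit p x \<Longrightarrow> y \<in> T"
  shows "orbit (perm_restrict p T) x = orbit p x"
  by (rule orbit_cong[OF permutes_orbit_self[OF assms(1,2)]])
    (simp add: perm_restrict_def assms(3))

lemma orbit_disjoint:
  assumes "p permutes S" "finite S" "x \<notin> orbit p a" "y \<in> orbit p x"
  shows "y \<notin> orbit p a"
proof
  assume "y \<in> orbit p a"
  moreover have "x \<in> orbit p y"
    by (rule orbit_swap[OF permutes_orbit_self[OF assms(1,2)] assms(4)])
  ultimately have "x \<in> orbit p a" by (rule orbit_trans[rotated])
  with assms(3) show False by simp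
qed

text \<open>Restriction to \<open>C\<close> and to \<open>S - C\<close> is a bijection onto pairs,
  with composition as its inverse. The assumption \<open>r < card C\<close> ensures that the cycle
  glued in respects the length condition.\<close>

lemma card_long_cycle_perms_orbit:
  assumes S: "finite S" "a \<in> C" "C \<subseteq> S" and r: "r < card C"
  shows "card {p \<in> long_cycle_perms r S. orbit p a = C}
    = card (full_cycles C a) * card (long_cycle_perms r (S - C))"
proof -
  let ?A = "{p \<in> long_cycle_perms r S. orbit p a = C}"
  let ?B = "full_cycles C a \<times> long_cycle_perms r (S - C)"
  have aS: "a \<in> S" using S by auto
  have finC: "finite C" using S finite_subset by blast
  have "bij_betw (\<lambda>p. (perm_restrict p C, perm_restrict p (S - C))) ?A ?B"
  proof (rule bij_betw_byWitness[where f' = "\<lambda>(p, q). p \<circ> q"])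
    show "\<forall>p\<in>?A. (case (perm_restrict p C, perm_restrict p (S - C)) of (p, q) \<Rightarrow> p \<circ> q) = p"
    proof
      fix p assume p: "p \<in> ?A"
      hence pS: "p permutes S" and o: "orbit p a = C" by (auto simp: long_cycle_perms_def)
      have c: "cyclic_on p C" using cyclic_on_orbit[OF pS S(1)] o by metis
      have "perm_restrict p C \<circ> perm_restrict p (S - C) = perm_restrict p (C \<union> (S - C))"
        by (rule perm_restrict_union)
          (use perm_restrict_orbit_permutes[OF pS S(1) aS] perm_restrict_diff_cyclic[OF pS c] o in auto)
      thus "(case (perm_restrict p C, perm_restrict p (S - C)) of (p, q) \<Rightarrow> p \<circ> q) = p"
        using S(3) perm_restrict_id[OF pS] by (simp add: Un_absorb1)
    qed
    have comp: "(p \<circ> q) permutes S" "\<And>x. x \<in> C \<Longrightarrow> (p \<circ> q) x = p x"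
        "\<And>x. x \<in> S - C \<Longrightarrow> (p \<circ> q) x = q x"
      if pq: "p permutes C" "q permutes S - C" for p q
    proof -
      show "(p \<circ> q) permutes S"
        using permutes_compose[OF permutes_subset[OF pq(2)] permutes_subset[OF pq(1)]] S(3) by blast
      show "(p \<circ> q) x = p x" if "x \<in> C" for x
        using permutes_not_in[OF pq(2)] that by simp
      show "(p \<circ> q) x = q x" if "x \<in> S - C" for x
        using permutes_not_in[OF pq(1)] permutes_in_image[OF pq(2), of x] that by simp
    qed
    show "\<forall>b\<in>?B. (\<lambda>p. (perm_restrict p C, perm_restrict p (S - C))) (case b of (p, q) \<Rightarrow> p \<circ> q) = b"
    proof
      fix b assume "b \<in> ?B"
      then obtain p q where b: "b = (p, q)" and "p \<in> full_cycles C a"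
        "q \<in> long_cycle_perms r (S - C)" by blast
      hence pq: "p permutes C" "q permutes S - C"
        by (auto simp: full_cycles_def long_cycle_perms_def)
      have "(perm_restrict (p \<circ> q) C, perm_restrict (p \<circ> q) (S - C)) = (p, q)"
        using comp[OF pq] permutes_not_in[OF pq(1)] permutes_not_in[OF pq(2)]
        by (auto simp: perm_restrict_def fun_eq_iff)
      thus "(\<lambda>p. (perm_restrict p C, perm_restrict p (S - C))) (case b of (p, q) \<Rightarrow> p \<circ> q) = b"
        by (simp add: b)
    qed
    show "(\<lambda>p. (perm_restrict p C, perm_restrict p (S - C))) ` ?A \<subseteq> ?B"
    proof (rule image_subsetI)
      fix p assume "p \<in> ?A"
      hence p: "p \<in> long_cycle_perms r S" and o: "C = orbit p a" by auto
      hence pS: "p permutes S" by (auto simp: long_cycle_perms_def)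
      have c: "cyclic_on p (orbit p a)" using cyclic_on_orbit[OF pS S(1)] by metis
      have "perm_restrict p (orbit p a) \<in> full_cycles (orbit p a) a"
        unfolding full_cycles_def
        using perm_restrict_orbit_permutes[OF pS S(1) aS] orbit_perm_restrict[OF pS S(1), of a "orbit p a"]
        by auto
      moreover have "r < card (orbit (perm_restrict p (S - orbit p a)) x)" if "x \<in> S - orbit p a" for x
      proof -
        have "orbit (perm_restrict p (S - orbit p a)) x = orbit p x"
          by (rule orbit_perm_restrict[OF pS S(1)])
            (use that permutes_orbit_subset[OF pS, of x] orbit_disjoint[OF pS S(1), of x a] in blast)
        thus ?thesis using p that by (simp add: long_cycle_perms_def)
      qed
      hence "perm_restrict p (S - orbit p a) \<in> long_cycle_perms r (S - orbit p a)"
        using perm_restrict_diff_cyclic[OF pS c] by (simp add: long_cycle_perms_def)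
      ultimately show "(perm_restrict p C, perm_restrict p (S - C)) \<in> ?B" using o by simp
    qed
    show "(\<lambda>(p, q). p \<circ> q) ` ?B \<subseteq> ?A"
    proof (rule image_subsetI)
      fix b assume "b \<in> ?B"
      then obtain p q where b: "b = (p, q)" and p: "p \<in> full_cycles C a"
        and q: "q \<in> long_cycle_perms r (S - C)" by blast
      hence pq: "p permutes C" "q permutes S - C" and o: "orbit p a = C"
        by (auto simp: full_cycles_def long_cycle_perms_def)
      have finSC: "finite (S - C)" using S by auto
      have 1: "orbit (p \<circ> q) x = orbit p x" if "x \<in> C" for x
        by (rule orbit_cong[OF permutes_orbit_self[OF pq(1) finC]])
          (rule comp(2)[OF pq], use that permutes_orbit_subset[OF pq(1)] in blast)
      have 2: "orbit (p \<circ> q) x = orbit q x" if "x \<in> S - C" for x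
        by (rule orbit_cong[OF permutes_orbit_self[OF pq(2) finSC]])
          (rule comp(3)[OF pq], use that permutes_orbit_subset[OF pq(2)] in blast)
      have 3: "orbit p x = C" if "x \<in> C" for x
        using orbit_cyclic_eq3[OF cyclic_on_orbit[OF pq(1) finC, of a]] that o by simp
      have "orbit (p \<circ> q) a = C" using 1 o S(2) by simp
      moreover have "r < card (orbit (p \<circ> q) x)" if "x \<in> S" for x
        using that 1 2 3 r q by (cases "x \<in> C") (auto simp: long_cycle_perms_def)
      hence "p \<circ> q \<in> long_cycle_perms r S"
        using comp(1)[OF pq] by (simp add: long_cycle_perms_def)
      ultimately show "(case b of (p, q) \<Rightarrow> p \<circ> q) \<in> ?A" by (simp add: b)
    qed
  qed
  hence "card ?A = card ?B" by (rule bij_betw_same_card)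
  thus ?thesis by (simp add: card_cartesian_product)
qed

section \<open>Counting by the cycle through a chosen point\<close>

text \<open>Removing \<open>a\<close> leaves the subsets of \<open>S - {a}\<close>, with cardinality
  lowered by one; grouping them by size yields the binomial coefficients.\<close>

lemma sum_subsets_containing:
  fixes f :: "nat \<Rightarrow> 'b::comm_semiring_1"
  assumes "finite S" "a \<in> S"
  shows "(\<Sum>C | a \<in> C \<and> C \<subseteq> S. f (card C))
    = (\<Sum>l=1..card S. of_nat ((card S - 1) choose (l - 1)) * f l)"
proof -
  define T where "T = S - {a}"
  have T: "finite T" "a \<notin> T" "S = insert a T" "card S = Suc (card T)"
    using assms card.remove[OF assms] by (auto simp: T_def)
  have bij: "bij_betw (insert a) (Pow T) {C. a \<in> C \<and> C \<subseteq> S}"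
    by (rule bij_betw_byWitness[where f' = "\<lambda>C. C - {a}"])
      (use T(2) in \<open>unfold T(3), blast+\<close>)
  have "(\<Sum>C | a \<in> C \<and> C \<subseteq> S. f (card C)) = (\<Sum>D\<in>Pow T. f (card (insert a D)))"
    by (rule sum.reindex_bij_betw[OF bij, symmetric])
  also have "\<dots> = (\<Sum>D\<in>Pow T. f (Suc (card D)))"
  proof (rule sum.cong)
    fix D assume "D \<in> Pow T"
    hence "finite D" "a \<notin> D" using T(1,2) by (auto intro: finite_subset)
    thus "f (card (insert a D)) = f (Suc (card D))" by simp
  qed simp
  also have "\<dots> = (\<Sum>k\<in>{..card T}. \<Sum>D | D \<in> Pow T \<and> card D = k. f (Suc (card D)))"
    by (rule sum.group[symmetric]) (use T(1) in \<open>auto intro: card_mono\<close>)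
  also have "\<dots> = (\<Sum>k\<in>{..card T}. of_nat (card T choose k) * f (Suc k))"
  proof (rule sum.cong)
    fix k assume "k \<in> {..card T}"
    have "(\<Sum>D | D \<in> Pow T \<and> card D = k. f (Suc (card D))) = (\<Sum>D | D \<subseteq> T \<and> card D = k. f (Suc k))"
      by (rule sum.cong) auto
    thus "(\<Sum>D | D \<in> Pow T \<and> card D = k. f (Suc (card D))) = of_nat (card T choose k) * f (Suc k)"
      by (simp add: n_subsets[OF T(1)])
  qed simp
  also have "\<dots> = (\<Sum>l=1..card S. of_nat ((card S - 1) choose (l - 1)) * f l)"
    by (rule sum.reindex_bij_witness[where i = "\<lambda>l. l - 1" and j = Suc])
      (auto simp: T(4))
  finally show ?thesis .
qed

text \<open>The permutations are sorted by the orbit \<open>C\<close> of \<open>a\<close>. Sets with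
  at most \<open>r\<close> elements do not occur as orbits, hence the value 0.\<close>

lemma card_long_cycle_perms_sum:
  assumes "finite S" "a \<in> S"
  shows "card (long_cycle_perms r S) = (\<Sum>C | a \<in> C \<and> C \<subseteq> S.
    if r < card C then card (full_cycles C a) * card (long_cycle_perms r (S - C)) else 0)"
proof -
  let ?I = "{C. a \<in> C \<and> C \<subseteq> S}"
  have "card (long_cycle_perms r S) = (\<Sum>p\<in>long_cycle_perms r S. 1)" by simp
  also have "\<dots> = (\<Sum>C\<in>?I. \<Sum>p | p \<in> long_cycle_perms r S \<and> orbit p a = C. 1)"
    proof (rule sum.group[symmetric])
    show "(\<lambda>p. orbit p a) ` long_cycle_perms r S \<subseteq> ?I"
      using permutes_orbit_subset[OF _ assms(2)] permutes_orbit_self[OF _ assms(1)]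
      by (auto simp: long_cycle_perms_def)
  qed (use assms(1) finite_long_cycle_perms in auto)
  also have "\<dots> = (\<Sum>C\<in>?I. if r < card C then card (full_cycles C a) * card (long_cycle_perms r (S - C)) else 0)"
  proof (rule sum.cong)
    fix C assume C: "C \<in> ?I"
    show "(\<Sum>p | p \<in> long_cycle_perms r S \<and> orbit p a = C. 1) =
      (if r < card C then card (full_cycles C a) * card (long_cycle_perms r (S - C)) else 0)"
    proof (cases "r < card C")
      case True
      thus ?thesis using card_long_cycle_perms_orbit[OF assms(1) _ _ True] C by auto
    next
      case False
      hence "{p \<in> long_cycle_perms r S. orbit p a = C} = {}"
        using assms(2) by (auto simp: long_cycle_perms_def)
      thus ?thesis using False by (metis (no_types, lifting) sum.empty)
    qed
  qed simp
  finally show ?thesis .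
qed

text \<open>Orbits are finite and nonempty, so the length condition is void for
  \<open>r = 0\<close>. This makes the cycle decomposition available for counting all
  permutations.\<close>

lemma long_cycle_perms_0:
  assumes "finite S"
  shows "long_cycle_perms 0 S = {p. p permutes S}"
proof -
  have "card (orbit p x) > 0" if "p permutes S" for p x
    unfolding card_gt_0_iff
    by (intro conjI orbit_nonempty finite_orbit permutes_orbit_self[OF that assms])
  thus ?thesis unfolding long_cycle_perms_def by blast
qed

text \<open>
  Counting all permutations by the cycle through \<open>a\<close> determines the number of full cycles
  recursively, so no explicit enumeration of cycles is needed.
\<close>

lemma card_full_cycles:
  assumes "finite S" "a \<in> S"
  shows "card (full_cycles S a) = fact (card S - 1)"
  using assms
proof (induction "card S" arbitrary: S rule: less_induct)
  case less
  let ?n = "card S"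
  let ?I = "{C. a \<in> C \<and> C \<subseteq> S}"
  have n: "?n \<ge> 1" using less.prems by (metis One_nat_def Suc_leI card_gt_0_iff empty_iff)
  have cI: "card C > 0" if "C \<in> ?I" for C
    using that less.prems by (auto simp: card_gt_0_iff intro: finite_subset)
  have fin: "finite ?I" using less.prems(1) by simp
  have SI: "S \<in> ?I" using less.prems by simp
  have cd: "card (S - C) = ?n - card C" if "C \<in> ?I" for C
    using that less.prems by (intro card_Diff_subset) (auto intro: finite_subset)
  have "fact ?n = (\<Sum>C\<in>?I. if 0 < card C then card (full_cycles C a) * card (long_cycle_perms 0 (S - C)) else 0)"
    using card_long_cycle_perms_sum[OF less.prems, of 0] less.prems(1)
    by (simp add: long_cycle_perms_0 card_permutations[OF refl])
  also have "\<dots> = (\<Sum>C\<in>?I. card (full_cycles C a) * fact (?n - card C))"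
    by (rule sum.cong)
      (use cI cd less.prems(1) in \<open>simp_all add: long_cycle_perms_0 card_permutations[OF refl]\<close>)
  also have "\<dots> = card (full_cycles S a) + (\<Sum>C\<in>?I - {S}. card (full_cycles C a) * fact (?n - card C))"
    using sum.remove[OF fin SI, of "\<lambda>C. card (full_cycles C a) * fact (?n - card C)"] by simp
  also have "(\<Sum>C\<in>?I - {S}. card (full_cycles C a) * fact (?n - card C))
      = (\<Sum>C\<in>?I - {S}. fact (card C - 1) * fact (?n - card C))"
  proof (rule sum.cong)
    fix C assume C: "C \<in> ?I - {S}"
    hence "card C < ?n" using less.prems by (intro psubset_card_mono) auto
    moreover have "finite C" using C less.prems by (auto intro: finite_subset)
    ultimately show "card (full_cycles C a) * fact (?n - card C) = fact (card C - 1) * fact (?n - card C)"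
      using less.hyps[of C] C by simp
  qed simp
  finally have 1: "fact ?n = card (full_cycles S a)
     + (\<Sum>C\<in>?I - {S}. fact (card C - 1) * fact (?n - card C))" .
  \<comment> \<open>With the expected number of full cycles for every \<open>C\<close>, the total is
    \<open>fact ?n\<close> as well. Cancelling the terms with \<open>C \<noteq> S\<close>, known by
    induction, leaves the claim for \<open>S\<close>.\<close>
  have "(\<Sum>C\<in>?I. fact (card C - 1) * fact (?n - card C) :: nat)
      = (\<Sum>l=1..?n. of_nat ((?n - 1) choose (l - 1)) * (fact (l - 1) * fact (?n - l)))"
    by (rule sum_subsets_containing[OF less.prems])
  also have "\<dots> = (\<Sum>l=1..?n. fact (?n - 1))"
  proof (rule sum.cong)
    fix l assume l: "l \<in> {1..?n}"
    have "fact (l - 1) * fact (?n - 1 - (l - 1)) * ((?n - 1) choose (l - 1)) = (fact (?n - 1) :: nat)"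
      by (rule binomial_fact_lemma) (use l in auto)
    moreover have "?n - 1 - (l - 1) = ?n - l" using l by auto
    ultimately show "of_nat ((?n - 1) choose (l - 1)) * (fact (l - 1) * fact (?n - l)) = (fact (?n - 1) :: nat)"
      by (simp add: algebra_simps)
  qed simp
  also have "\<dots> = fact ?n" using n by (cases ?n) auto
  finally have "fact ?n = (fact (?n - 1) :: nat) + (\<Sum>C\<in>?I - {S}. fact (card C - 1) * fact (?n - card C))"
    using sum.remove[OF fin SI, of "\<lambda>C. fact (card C - 1) * fact (?n - card C) :: nat"] by simp
  with 1 show ?case by linarith
qed

section \<open>\<open>kappa\<close> as a normalised count, and its recursion\<close>

lemma kappa_eq_card: "kappa n r = card (long_cycle_perms r {1..n}) / fact n"
proof -
  have "kappa n r = card ({p. p permutes {1..n}} \<inter> {p. \<forall>c\<in>perm_cycles n p. r < card c})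
      / card {p. p permutes {1..n}}"
    unfolding kappa_def
    by (rule measure_pmf_of_set) (use permutes_id finite_permutations in blast)+
  moreover have "{p. p permutes {1..n}} \<inter> {p. \<forall>c\<in>perm_cycles n p. r < card c} = long_cycle_perms r {1..n}"
    by (auto simp: perm_cycles_def long_cycle_perms_def)
  ultimately show ?thesis by (simp add: card_permutations[OF refl])
qed

lemma kappa_0: "kappa 0 r = 1"
  by (simp add: kappa_eq_card long_cycle_perms_def)

text \<open>That counts on proper subsets depend only on the cardinality is the assumption
  \<open>IH\<close>, since this recursion is itself the induction step in proving that fact.\<close>

lemma card_long_cycle_perms_rec:
  assumes "finite S" "a \<in> S" and n: "card S = n"
    and IH: "\<And>T. T \<subset> S \<Longrightarrow> card (long_cycle_perms r T) = N (card T)"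
  shows "card (long_cycle_perms r S) = (\<Sum>l=1..n. ((n - 1) choose (l - 1)) *
    (if r < l then fact (l - 1) * N (n - l) else 0))"
proof -
  have "card (long_cycle_perms r S) = (\<Sum>C | a \<in> C \<and> C \<subseteq> S.
    if r < card C then card (full_cycles C a) * card (long_cycle_perms r (S - C)) else 0)"
    by (rule card_long_cycle_perms_sum[OF assms(1,2)])
  also have "\<dots> = (\<Sum>C | a \<in> C \<and> C \<subseteq> S.
    if r < card C then fact (card C - 1) * N (card S - card C) else 0)"
  proof (rule sum.cong)
    fix C assume C: "C \<in> {C. a \<in> C \<and> C \<subseteq> S}"
    hence "finite C" using assms(1) finite_subset by auto
    moreover from this have "card (S - C) = card S - card C" using C by (simp add: card_Diff_subset)
    moreover have "S - C \<subset> S" using C assms(2) by auto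
    ultimately show "(if r < card C then card (full_cycles C a) * card (long_cycle_perms r (S - C)) else 0)
      = (if r < card C then fact (card C - 1) * N (card S - card C) else 0)"
      using IH[of "S - C"] card_full_cycles[of C a] C by simp
  qed simp
  also have "\<dots> = (\<Sum>l=1..card S. of_nat ((card S - 1) choose (l - 1)) *
    (if r < l then fact (l - 1) * N (card S - l) else 0))"
    by (rule sum_subsets_containing[OF assms(1,2)])
  finally show ?thesis unfolding n of_nat_id .
qed

text \<open>By strong induction: the right-hand side of \<open>card_long_cycle_perms_rec\<close>
  involves the set only through its cardinality.\<close>

lemma card_long_cycle_perms_cong:
  fixes S T :: "nat set"
  assumes "finite S" "finite T" "card S = card T"
  shows "card (long_cycle_perms r S) = card (long_cycle_perms r T)"
  using assms
proof (induction "card S" arbitrary: S T rule: less_induct)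
  case less
  define N where "N k = card (long_cycle_perms r {1..k})" for k :: nat
  show ?case
  proof (cases "S = {}")
    case False
    hence "T \<noteq> {}" using less.prems card_eq_0_iff by metis
    with False obtain a b where ab: "a \<in> S" "b \<in> T" by blast
    have N: "card (long_cycle_perms r U) = N (card U)" if "U \<subset> S \<or> U \<subset> T" for U
      unfolding N_def
    proof (rule less.hyps)
      show "card U < card S" using that less.prems psubset_card_mono by metis
      show "finite U" using that less.prems finite_subset by blast
    qed simp_all
    show ?thesis
      using card_long_cycle_perms_rec[OF less.prems(1) ab(1) less.prems(3), of r N]
        card_long_cycle_perms_rec[OF less.prems(2) ab(2) refl, of r N] N
      by simp
  qed (use less.prems in auto)
qed

text \<open>Split by the length \<open>l > r\<close> of the cycle through one point: the
  \<open>(n - 1 choose l - 1) (l - 1)!\<close> choices for the cycle times \<open>(n - l)!\<close>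
  give \<open>(n - 1)!\<close>, so all lengths contribute \<open>kappa (n - l) r\<close> with the
  same weight.\<close>

lemma kappa_sum:
  assumes "n \<ge> 1"
  shows "real n * kappa n r = (\<Sum>j<n - r. kappa j r)"
proof -
  let ?N = "\<lambda>k. card (long_cycle_perms r {1..k})"
  have N: "?N n = (\<Sum>l=1..n. ((n - 1) choose (l - 1)) * (if r < l then fact (l - 1) * ?N (n - l) else 0))"
  proof (rule card_long_cycle_perms_rec)
    fix T assume "T \<subset> {1..n}"
    hence "finite T" using finite_subset by blast
    thus "card (long_cycle_perms r T) = ?N (card T)"
      by (rule card_long_cycle_perms_cong) simp_all
  qed (use assms in auto)
  have "real n * kappa n r = ?N n / fact (n - 1)"
    using assms by (cases n) (simp_all add: kappa_eq_card)
  also have "\<dots> = (\<Sum>l=1..n. real (((n - 1) choose (l - 1)) * (if r < l then fact (l - 1) * ?N (n - l) else 0)) / fact (n - 1))"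
    by (subst N) (simp add: sum_divide_distrib)
  also have "\<dots> = (\<Sum>l=1..n. if r < l then kappa (n - l) r else 0)"
  proof (rule sum.cong)
    fix l assume l: "l \<in> {1..n}"
    have eq: "n - 1 - (l - 1) = n - l" using l by auto
    have "fact (l - 1) * fact (n - l) * ((n - 1) choose (l - 1)) = (fact (n - 1) :: nat)"
      using binomial_fact_lemma[OF diff_le_mono[of l n 1]] l unfolding eq by simp
    hence "real (fact (l - 1) * fact (n - l) * ((n - 1) choose (l - 1))) = fact (n - 1)"
      by (metis of_nat_fact)
    hence e: "fact (n - 1) = fact (l - 1) * fact (n - l) * real ((n - 1) choose (l - 1))"
      by simp
    have "(n - 1) choose (l - 1) \<noteq> 0" using l by auto
    hence "real ((n - 1) choose (l - 1)) * (fact (l - 1) * x) / fact (n - 1) = x / fact (n - l)" for x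
      unfolding e by simp
    thus "real (((n - 1) choose (l - 1)) * (if r < l then fact (l - 1) * ?N (n - l) else 0)) / fact (n - 1)
      = (if r < l then kappa (n - l) r else 0)"
      by (simp add: kappa_eq_card)
  qed simp
  also have "\<dots> = (\<Sum>l=Suc r..n. kappa (n - l) r)"
    by (rule sum.mono_neutral_cong_right) auto
  also have "\<dots> = (\<Sum>j<n - r. kappa j r)"
    by (rule sum.reindex_bij_witness[where i = "\<lambda>j. n - j" and j = "\<lambda>l. n - l"]) auto
  finally show ?thesis .
qed

lemma kappa_eq_0: "1 \<le> n \<Longrightarrow> n \<le> r \<Longrightarrow> kappa n r = 0"
  using kappa_sum[of n r] by simp

lemma kappa_rec:
  assumes "n \<ge> 1" "n \<ge> r"
  shows "real (n + 1) * kappa (n + 1) r = real n * kappa n r + kappa (n - r) r"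
  using kappa_sum[of n r] kappa_sum[of "n + 1" r] assms by (simp add: Suc_diff_le)

text \<open>In \<open>kappa_sum\<close> only \<open>j = 0\<close> survives, since
  \<open>kappa\<close> vanishes from 1 to \<open>r\<close>. Two cycles would need at least
  \<open>2 * r + 2\<close> points, so there is a single cycle.\<close>

lemma kappa_eq_inverse:
  assumes "r < n" "n \<le> 2 * r + 1"
  shows "kappa n r = 1 / n"
proof -
  have "(\<Sum>j<n - r. kappa j r) = (\<Sum>j\<in>{0}. kappa j r)"
    by (rule sum.mono_neutral_right) (use assms in \<open>auto intro!: kappa_eq_0\<close>)
  hence "real n * kappa n r = 1" using kappa_sum[of n r] assms by (simp add: kappa_0)
  thus ?thesis using assms by (simp add: eq_divide_eq mult.commute)
qed

section \<open>The limit of \<open>kappa\<close> for fixed \<open>r\<close>\<close>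

text \<open>
  The generating function of the differences of \<open>kappa\<close> solves \<open>A' = -(1 + x + \<dots> + x\<^bsup>r-1\<^esup>) A\<close> and
  converges beyond \<open>x = 1\<close>.
\<close>

lemma kappa_tendsto:
  assumes r: "r \<ge> 1"
  shows "(\<lambda>n. kappa n r) \<longlonglongrightarrow> exp (- harm r)"
proof -
  \<comment> \<open>\<open>a 0 = kappa 0 r\<close> makes the partial sums of \<open>a\<close> equal
    to \<open>kappa\<close>.\<close>
  define a where "a n = (case n of 0 \<Rightarrow> 1 | Suc k \<Rightarrow> kappa (Suc k) r - kappa k r)" for n
  have a0: "a 0 = 1" and aS: "a (Suc k) = kappa (Suc k) r - kappa k r" for k
    by (simp_all add: a_def)
  have psum: "(\<Sum>k<Suc n. a k) = kappa n r" for n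
    by (induction n) (simp_all add: a0 aS kappa_0)
  have window: "(\<Sum>j<r. if j \<le> n then a (n - j) else 0)
      = kappa n r - (if r \<le> n then kappa (n - r) r else 0)" for n
  proof -
    have "(\<Sum>j<i. if j \<le> n then a (n - j) else 0) = kappa n r - (if i \<le> n then kappa (n - i) r else 0)" for i
    proof (induction i)
      case (Suc i)
      consider "i < n" | "i = n" | "i > n" by linarith
      thus ?case
      proof cases
        case 1
        hence "n - i = Suc (n - Suc i)" by simp
        thus ?thesis using Suc 1 by (simp add: aS)
      qed (use Suc in \<open>simp_all add: a0 kappa_0\<close>)
    qed simp
    thus ?thesis .
  qed
  \<comment> \<open>Below \<open>r\<close> the values are read off directly: \<open>kappa\<close> is
    1 at 0 and 0 from 1 to \<open>r\<close>.\<close>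
  have rec: "real (Suc n) * a (Suc n) = - (\<Sum>j<r. if j \<le> n then a (n - j) else 0)" for n
  proof -
    consider "n \<ge> r" | "n = 0" | "n < r" "n \<ge> 1" by linarith
    thus ?thesis
    proof cases
      case 1
      thus ?thesis unfolding window aS using kappa_rec[of n r] r by (simp add: algebra_simps)
    next
      case 2
      thus ?thesis unfolding window aS using r kappa_eq_0[of 1 r] by (simp add: kappa_0)
    next
      case 3
      thus ?thesis unfolding window aS using kappa_eq_0[of n r] kappa_eq_0[of "Suc n" r] by simp
    qed
  qed
  \<comment> \<open>\<open>C\<close> makes the bound trivial up to \<open>2 ^ Suc r\<close>. Beyond,
    the geometric sum over the window loses at most the factor \<open>2 ^ Suc r\<close>, which the
    division by \<open>n\<close> repays.\<close>
  define C where "C = (\<Sum>k\<le>2 ^ Suc r. \<bar>a k\<bar> * 2 ^ k)"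
  have C0: "C \<ge> 0" unfolding C_def by (intro sum_nonneg) auto
  have bound: "\<bar>a n\<bar> \<le> C / 2 ^ n" for n
  proof (induction n rule: less_induct)
    case (less n)
    show ?case
    proof (cases "n \<le> 2 ^ Suc r")
      case True
      have "\<bar>a n\<bar> * 2 ^ n \<le> C"
        unfolding C_def by (rule member_le_sum) (use True in auto)
      thus ?thesis by (simp add: field_simps)
    next
      case False
      then obtain m where m: "n = Suc m" by (cases n) auto
      have "real n * \<bar>a n\<bar> = \<bar>\<Sum>j<r. if j \<le> m then a (m - j) else 0\<bar>"
        using rec[of m] unfolding m by (metis abs_minus_cancel abs_mult abs_of_nat)
      also have "\<dots> \<le> (\<Sum>j<r. \<bar>if j \<le> m then a (m - j) else 0\<bar>)" by (rule sum_abs)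
      also have "\<dots> \<le> (\<Sum>j<r. C / 2 ^ m * 2 ^ j)"
      proof (rule sum_mono)
        fix j assume "j \<in> {..<r}"
        show "\<bar>if j \<le> m then a (m - j) else 0\<bar> \<le> C / 2 ^ m * 2 ^ j"
        proof (cases "j \<le> m")
          case True
          have "\<bar>a (m - j)\<bar> \<le> C / 2 ^ (m - j)" using less m by simp
          also have "\<dots> = C / 2 ^ m * 2 ^ j" using True by (simp add: power_diff)
          finally show ?thesis using True by simp
        qed (use C0 in simp)
      qed
      also have "\<dots> = C / 2 ^ m * (\<Sum>j<r. 2 ^ j)" by (rule sum_distrib_left[symmetric])
      also have "(\<Sum>j<r. (2::real) ^ j) = 2 ^ r - 1" by (simp add: geometric_sum)
      also have "C / 2 ^ m * (2 ^ r - 1) \<le> C / 2 ^ m * 2 ^ r" using C0 by (intro mult_left_mono) auto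
      also have "\<dots> = 2 ^ Suc r * (C / 2 ^ n)" by (simp add: m)
      also have "\<dots> \<le> real n * (C / 2 ^ n)"
      proof (rule mult_right_mono)
        have "real (2 ^ Suc r) \<le> real n" using False by linarith
        thus "(2::real) ^ Suc r \<le> real n" by simp
      qed (use C0 in simp)
      finally have "real n * \<bar>a n\<bar> \<le> real n * (C / 2 ^ n)" .
      thus ?thesis by (rule mult_left_le_imp_le) (use m in simp)
    qed
  qed
  \<comment> \<open>Any ratio strictly between 1 and 2 would serve: the point 1 has to lie inside
    the disc of convergence.\<close>
  have summ: "summable (\<lambda>n. a n * (3/2) ^ n)"
  proof (rule summable_comparison_test')
    show "summable (\<lambda>n. C * (3/4) ^ n)" by (intro summable_mult summable_geometric) simp
    fix n :: nat
    have "\<bar>a n\<bar> * (3/2) ^ n \<le> C / 2 ^ n * (3/2) ^ n" by (intro mult_right_mono bound) simp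
    also have "\<dots> = C * (3/4) ^ n" by (simp add: power_divide flip: power_mult_distrib)
    finally show "norm (a n * (3/2) ^ n) \<le> C * (3/4) ^ n" by (simp add: abs_mult)
  qed
  define A where "A x = (\<Sum>n. a n * x ^ n)" for x :: real
  have summx: "summable (\<lambda>n. a n * x ^ n)" if "\<bar>x\<bar> < 3/2" for x
    by (rule powser_inside[OF summ]) (use that in auto)
  have dA: "(A has_real_derivative - ((\<Sum>j<r. x ^ j) * A x)) (at x)" if x: "\<bar>x\<bar> < 3/2" for x
  proof -
    have "(A has_real_derivative (\<Sum>n. diffs a n * x ^ n)) (at x)"
      unfolding A_def by (rule termdiffs_strong[OF summ]) (use x in auto)
    also have "(\<lambda>n. diffs a n * x ^ n) = (\<lambda>n. \<Sum>j<r. - ((if j \<le> n then a (n - j) else 0) * x ^ n))"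
      unfolding diffs_def rec by (simp add: sum_distrib_right sum_negf)
    also have "suminf \<dots> = (\<Sum>j<r. - (x ^ j * A x))"
    proof (rule sums_unique[symmetric], rule sums_sum)
      fix j assume "j \<in> {..<r}"
      have "(\<lambda>n. a n * x ^ n) sums A x" unfolding A_def by (rule summable_sums[OF summx[OF x]])
      hence "(\<lambda>n. x ^ j * (a n * x ^ n)) sums (x ^ j * A x)" by (rule sums_mult)
      hence "(\<lambda>n. (if j \<le> n + j then a (n + j - j) else 0) * x ^ (n + j)) sums (x ^ j * A x)"
        by (simp add: power_add mult_ac)
      hence "(\<lambda>n. (if j \<le> n then a (n - j) else 0) * x ^ n) sums (x ^ j * A x)"
        by (subst (asm) sums_zero_iff_shift) auto
      thus "(\<lambda>n. - ((if j \<le> n then a (n - j) else 0) * x ^ n)) sums (- (x ^ j * A x))"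
        by (rule sums_minus)
    qed
    also have "\<dots> = - ((\<Sum>j<r. x ^ j) * A x)" by (simp add: sum_negf sum_distrib_right)
    finally show ?thesis .
  qed
  let ?S = "\<lambda>x::real. \<Sum>j<r. x ^ Suc j / real (Suc j)"
  have dS: "(?S has_real_derivative (\<Sum>j<r. x ^ j)) (at x)" for x
  proof (rule DERIV_sum)
    fix j assume "j \<in> {..<r}"
    have "((\<lambda>x. x ^ Suc j / real (Suc j)) has_real_derivative real (Suc j) * x ^ j / real (Suc j)) (at x)"
      using DERIV_cdivide[OF DERIV_pow[of "Suc j" x UNIV], of "real (Suc j)"] by simp
    thus "((\<lambda>x. x ^ Suc j / real (Suc j)) has_real_derivative x ^ j) (at x)" by simp
  qed
  \<comment> \<open>The integrating factor \<open>exp (?S x)\<close> turns the differential equation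
    into constancy; \<open>?S\<close> is the harmonic number at 1 and 0 at 0.\<close>
  have "A 1 * exp (?S 1) = A 0 * exp (?S 0)"
  proof (rule DERIV_isconst_end[where f = "\<lambda>x. A x * exp (?S x)"])
    have der: "((\<lambda>x. A x * exp (?S x)) has_real_derivative 0) (at x)" if "\<bar>x\<bar> < 3/2" for x
      using DERIV_mult[OF dA[OF that] DERIV_fun_exp[OF dS[of x]]] by (simp add: algebra_simps)
    show "((\<lambda>x. A x * exp (?S x)) has_real_derivative 0) (at x)" if "0 < x" "x < 1" for x
      by (rule der) (use that in auto)
    show "continuous_on {0..1} (\<lambda>x. A x * exp (?S x))"
    proof (rule continuous_at_imp_continuous_on, rule ballI)
      fix x :: real assume "x \<in> {0..1}"
      thus "isCont (\<lambda>x. A x * exp (?S x)) x" by (intro DERIV_isCont[OF der]) auto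
    qed
  qed simp
  moreover have "A 0 = 1" unfolding A_def by (simp add: a0)
  moreover have "?S 1 = harm r"
    unfolding harm_def
    by (rule sum.reindex_bij_witness[where i = "\<lambda>k. k - 1" and j = Suc]) (auto simp: inverse_eq_divide)
  ultimately have "A 1 = exp (- harm r)" by (simp add: exp_minus field_simps)
  moreover have "(\<lambda>n. \<Sum>k<Suc n. a k) \<longlonglongrightarrow> A 1"
  proof -
    have "a sums A 1" unfolding A_def using summable_sums[OF summx[of 1]] by simp
    thus ?thesis unfolding sums_def by (rule LIMSEQ_Suc)
  qed
  ultimately show ?thesis unfolding psum by simp
qed

section \<open>Dickman's function\<close>

lemma continuous_on_dickman: "continuous_on {0..} dickman"
  and dickman_eq_1: "0 \<le> v \<Longrightarrow> v \<le> 1 \<Longrightarrow> dickman v = 1"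
  using is_dickman_dickman by (auto simp: is_dickman_def)

lemma continuous_on_dickman': "A \<subseteq> {0..} \<Longrightarrow> continuous_on A dickman"
  using continuous_on_dickman continuous_on_subset by blast

lemma has_real_derivative_dickman:
  assumes "v > 1"
  shows "(dickman has_real_derivative - dickman (v - 1) / v) (at v)"
proof -
  have "dickman differentiable (at v)" and e: "v * deriv dickman v + dickman (v - 1) = 0"
    using is_dickman_dickman assms by (auto simp: is_dickman_def)
  hence "(dickman has_real_derivative deriv dickman v) (at v)"
    using DERIV_imp_deriv by (fastforce simp: real_differentiable_def)
  moreover have "deriv dickman v = - dickman (v - 1) / v"
    using e assms by (simp add: field_simps)
  ultimately show ?thesis by simp
qed

text \<open>Differences of this antiderivative stand for integrals of \<open>dickman\<close>. The
  cut-off at 0 keeps the integrand continuous on the whole line although \<open>dickman\<close>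
  jumps there.\<close>

definition dickman_prim :: "real \<Rightarrow> real" where
  "dickman_prim = (SOME P. \<forall>x. (P has_real_derivative dickman (max 0 x)) (at x))"

lemma has_real_derivative_dickman_prim:
  assumes "x \<ge> 0"
  shows "(dickman_prim has_real_derivative dickman x) (at x)"
proof -
  have "continuous_on UNIV (\<lambda>x::real. dickman (max 0 x))"
  proof (rule continuous_on_compose2[OF continuous_on_dickman])
    show "continuous_on UNIV (\<lambda>x::real. max 0 x)" by (intro continuous_intros)
  qed auto
  hence "\<exists>P. \<forall>x. (P has_real_derivative dickman (max 0 x)) (at x)"
    by (rule antiderivative_ex)
  hence "\<forall>x. (dickman_prim has_real_derivative dickman (max 0 x)) (at x)"
    unfolding dickman_prim_def by (rule someI_ex)
  hence "(dickman_prim has_real_derivative dickman (max 0 x)) (at x)" ..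
  thus ?thesis using assms by simp
qed

lemma continuous_on_dickman_prim: "A \<subseteq> {0..} \<Longrightarrow> continuous_on A dickman_prim"
  by (rule continuous_at_imp_continuous_on)
    (auto intro!: DERIV_isCont[OF has_real_derivative_dickman_prim])

section \<open>Integral form of the delay equation, positivity and monotonicity\<close>

lemma dickman_prim_diff:
  assumes "0 \<le> x" "x < y"
  obtains \<xi> where "x < \<xi>" "\<xi> < y" "dickman_prim y - dickman_prim x = (y - x) * dickman \<xi>"
  using MVT2[of x y dickman_prim dickman] assms has_real_derivative_dickman_prim by force

lemma has_real_derivative_mult_dickman:
  assumes "v > 1"
  shows "((\<lambda>v. v * dickman v) has_real_derivative dickman v - dickman (v - 1)) (at v)"
  by (rule derivative_eq_intros has_real_derivative_dickman[OF assms] | use assms in simp)+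

text \<open>Both sides have derivative \<open>dickman u - dickman (u - 1)\<close> for
  \<open>u > 1\<close>, and they agree at 1 because \<open>dickman\<close> is 1 on
  \<open>[0, 1]\<close>.\<close>

lemma dickman_integral_eq:
  assumes "u \<ge> 1"
  shows "u * dickman u = dickman_prim u - dickman_prim (u - 1)"
proof -
  let ?g = "\<lambda>u. u * dickman u - (dickman_prim u - dickman_prim (u - 1))"
  have c: "continuous_on {1..u} (\<lambda>u. dickman_prim (u - 1))"
    by (rule continuous_on_compose2[OF continuous_on_dickman_prim[of "{0..}"]])
      (auto intro!: continuous_intros)
  have "?g u = ?g 1"
  proof (cases "u = 1")
    case False
    show ?thesis
    proof (rule DERIV_isconst2[of 1 u])
      show "continuous_on {1..u} ?g"
        by (intro continuous_intros continuous_on_dickman' continuous_on_dickman_prim c) auto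
      fix x assume x: "1 < x" "x < u"
      have d: "((\<lambda>x. dickman_prim (x - 1)) has_real_derivative dickman (x - 1) * 1) (at x)"
        by (rule DERIV_chain2[of dickman_prim _ "\<lambda>x. x - 1"])
          (use x in \<open>auto intro!: derivative_eq_intros has_real_derivative_dickman_prim\<close>)
      show "(?g has_real_derivative 0) (at x)"
        using DERIV_diff[OF has_real_derivative_mult_dickman[OF x(1)]
            DERIV_diff[OF has_real_derivative_dickman_prim[of x] d]] x by simp
    qed (use assms False in auto)
  qed simp
  moreover obtain \<xi> where "0 < \<xi>" "\<xi> < 1" "dickman_prim 1 - dickman_prim 0 = (1 - 0) * dickman \<xi>"
    using dickman_prim_diff[of 0 1] by auto
  ultimately show ?thesis by (simp add: dickman_eq_1)
qed

text \<open>At a first point \<open>z\<close> with a nonpositive value, \<open>z > 1\<close> and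
  \<open>z * dickman z\<close> is the integral over \<open>[z - 1, z]\<close> of a function positive
  before \<open>z\<close>, a contradiction.\<close>

lemma dickman_pos:
  assumes "u \<ge> 0"
  shows "dickman u > 0"
proof (rule ccontr)
  assume neg: "\<not> dickman u > 0"
  define Z where "Z = {0..} \<inter> dickman -` {..0}"
  have Z: "closed Z" "bdd_below Z" "Z \<noteq> {}"
    unfolding Z_def using neg assms continuous_closed_preimage[OF continuous_on_dickman]
    by (auto intro!: bdd_belowI[of _ 0])
  have z: "Inf Z \<in> Z" using closed_contains_Inf[OF Z(3,2,1)] .
  have pos: "dickman t > 0" if "0 \<le> t" "t < Inf Z" for t
    using that cInf_lower[OF _ Z(2), of t] by (force simp: Z_def)
  have z1: "Inf Z > 1"
    using z dickman_eq_1[of "Inf Z"] by (cases "Inf Z \<le> 1") (auto simp: Z_def)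
  obtain \<xi> where \<xi>: "Inf Z - 1 < \<xi>" "\<xi> < Inf Z"
    "dickman_prim (Inf Z) - dickman_prim (Inf Z - 1) = (Inf Z - (Inf Z - 1)) * dickman \<xi>"
    using dickman_prim_diff[of "Inf Z - 1" "Inf Z"] z1 by auto
  have "Inf Z * dickman (Inf Z) > 0"
    using dickman_integral_eq[of "Inf Z"] z1 \<xi> pos[of \<xi>] by simp
  with z z1 show False by (simp add: Z_def zero_less_mult_iff)
qed

lemma dickman_nonzero: "u \<ge> 0 \<Longrightarrow> dickman u \<noteq> 0"
  using dickman_pos[of u] by simp

lemma dickman_less:
  assumes "1 \<le> x" "x < y"
  shows "dickman y < dickman x"
proof (rule DERIV_neg_imp_decreasing_open[OF assms(2)])
  show "continuous_on {x..y} dickman" using assms by (intro continuous_on_dickman') auto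
  show "\<exists>d. (dickman has_real_derivative d) (at t) \<and> d < 0" if "x < t" "t < y" for t
    using has_real_derivative_dickman[of t] dickman_pos[of "t - 1"] that assms
    by (intro exI[of _ "- dickman (t - 1) / t"]) (auto simp: divide_simps)
qed

lemma dickman_antimono:
  assumes "0 \<le> x" "x \<le> y"
  shows "dickman y \<le> dickman x"
proof -
  consider "x = y" | "1 \<le> x" "x < y" | "x < 1" "y \<le> 1" | "x < 1" "1 < y"
    using assms by linarith
  thus ?thesis
    by cases (use dickman_less[of x y] dickman_less[of 1 y] dickman_eq_1[of x] dickman_eq_1[of y]
      dickman_eq_1[of 1] assms in auto)
qed

lemma dickman_le_1: "0 \<le> x \<Longrightarrow> dickman x \<le> 1"
  using dickman_antimono[of 0 x] dickman_eq_1[of 0] by simp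

lemma dickman_mult_le:
  assumes "u \<ge> 1"
  shows "u * dickman u \<le> dickman (u - 1)"
proof -
  obtain \<xi> where \<xi>: "u - 1 < \<xi>" "\<xi> < u"
    "dickman_prim u - dickman_prim (u - 1) = (u - (u - 1)) * dickman \<xi>"
    using dickman_prim_diff[of "u - 1" u] assms by auto
  thus ?thesis using dickman_integral_eq[OF assms] dickman_antimono[of "u - 1" \<xi>] assms by simp
qed

text \<open>Only the left half of the integral over \<open>[u - 1, u]\<close> is kept, where
  \<open>dickman\<close> is at least its value at the midpoint.\<close>

lemma dickman_half_le:
  assumes "u \<ge> 1"
  shows "dickman (u - 1/2) \<le> 2 * u * dickman u"
proof -
  obtain \<xi> where \<xi>: "u - 1 < \<xi>" "\<xi> < u - 1/2"
    "dickman_prim (u - 1/2) - dickman_prim (u - 1) = (u - 1/2 - (u - 1)) * dickman \<xi>"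
    using dickman_prim_diff[of "u - 1" "u - 1/2"] assms by auto
  obtain \<eta> where \<eta>: "u - 1/2 < \<eta>" "\<eta> < u"
    "dickman_prim u - dickman_prim (u - 1/2) = (u - (u - 1/2)) * dickman \<eta>"
    using dickman_prim_diff[of "u - 1/2" u] assms by auto
  show ?thesis
    using dickman_integral_eq[OF assms] \<xi> \<eta> dickman_antimono[of \<xi> "u - 1/2"] dickman_pos[of \<eta>] assms
    by simp
qed

text \<open>A converse to \<open>dickman_mult_le\<close> with polynomial loss, by two half steps;
  \<open>u \<ge> 3/2\<close> makes both admissible.\<close>

lemma dickman_shift_le:
  assumes "u \<ge> 3/2"
  shows "dickman (u - 1) \<le> 4 * u\<^sup>2 * dickman u"
proof -
  have "dickman (u - 1) \<le> 2 * (u - 1/2) * dickman (u - 1/2)"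
    using dickman_half_le[of "u - 1/2"] assms by simp
  also have "\<dots> \<le> 2 * u * (2 * u * dickman u)"
    using dickman_half_le[of u] assms dickman_pos[of "u - 1/2"] by (intro mult_mono) auto
  finally show ?thesis by (simp add: power2_eq_square)
qed

section \<open>The logarithmic derivative of Dickman's function\<close>

text \<open>By the delay equation this is \<open>-\<rho>'(u)/\<rho>(u)\<close> for \<open>u > 1\<close>.\<close>

definition dickman_ratio :: "real \<Rightarrow> real" where
  "dickman_ratio u = dickman (u - 1) / (u * dickman u)"

lemma dickman_minus_1: "u \<ge> 1 \<Longrightarrow> dickman (u - 1) = u * dickman_ratio u * dickman u"
  using dickman_pos[of u] by (simp add: dickman_ratio_def)

lemma continuous_on_dickman_shift: "A \<subseteq> {1..} \<Longrightarrow> continuous_on A (\<lambda>u. dickman (u - 1))"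
  by (rule continuous_on_compose2[OF continuous_on_dickman]) (auto intro!: continuous_intros)

lemma continuous_on_dickman_ratio: "continuous_on {1..} dickman_ratio"
  unfolding dickman_ratio_def[abs_def]
  by (intro continuous_intros continuous_on_dickman' continuous_on_dickman_shift)
    (auto simp: dickman_nonzero)

lemma has_real_derivative_dickman':
  "v > 1 \<Longrightarrow> (dickman has_real_derivative - (dickman_ratio v * dickman v)) (at v)"
  using has_real_derivative_dickman[of v] dickman_pos[of v] by (simp add: dickman_ratio_def)

lemma dickman_ratio_ge_1: "u \<ge> 1 \<Longrightarrow> dickman_ratio u \<ge> 1"
  using dickman_mult_le[of u] dickman_pos[of u] by (simp add: dickman_ratio_def divide_simps)

text \<open>
  The expression assumed negative below is, up to the positive factor \<open>dickman (t - 1)\<close>, the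
  derivative of the reciprocal of \<open>dickman_ratio\<close>. It is an integral of
  \<open>(dickman_ratio (t - 1) - dickman_ratio x) * dickman x\<close> over \<open>x\<close>, hence cannot have a first zero.
\<close>

lemma dickman_ratio_less_aux:
  assumes J: "\<And>t. 2 \<le> t \<Longrightarrow> t < z \<Longrightarrow> dickman t - dickman (t - 1) + dickman_ratio (t - 1) * (t * dickman t) < 0"
    and xy: "1 \<le> x" "x < y" "y \<le> z"
  shows "dickman_ratio x < dickman_ratio y"
proof -
  define F where "F u = u * dickman u / dickman (u - 1)" for u
  have contF: "continuous_on A F" if "A \<subseteq> {1..}" for A
    unfolding F_def
    by (intro continuous_intros continuous_on_dickman' continuous_on_dickman_shift)
      (use that in \<open>auto simp: dickman_nonzero subset_iff\<close>)
  \<comment> \<open>Up to 2 the denominator \<open>dickman (u - 1)\<close> is constantly 1, so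
    \<open>F\<close> is \<open>u * dickman u\<close>; the derivative of the denominator in terms of
    \<open>dickman_ratio\<close> is available only beyond 2.\<close>
  have F1: "F y < F x" if "1 \<le> x" "x < y" "y \<le> 2" for x y
  proof (rule DERIV_neg_imp_decreasing_open[OF that(2)])
    show "continuous_on {x..y} F" using that by (intro contF) auto
    fix t assume t: "x < t" "t < y"
    have "((\<lambda>v. v * dickman v) has_real_derivative dickman t - dickman (t - 1)) (at t)"
      using has_real_derivative_mult_dickman[of t] t that by simp
    hence "(F has_real_derivative dickman t - dickman (t - 1)) (at t)"
      by (rule has_field_derivative_transform_within_open[of _ _ _ "{1<..<2}"])
        (use t that in \<open>auto simp: F_def dickman_eq_1\<close>)
    moreover have "dickman t < dickman (t - 1)"
      using dickman_less[of 1 t] t that by (simp add: dickman_eq_1)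
    ultimately show "\<exists>d. (F has_real_derivative d) (at t) \<and> d < 0" by force
  qed
  have F2: "F y < F x" if "2 \<le> x" "x < y" "y \<le> z" for x y
  proof (rule DERIV_neg_imp_decreasing_open[OF that(2)])
    show "continuous_on {x..y} F" using that by (intro contF) auto
    fix t assume t: "x < t" "t < y"
    let ?J = "dickman t - dickman (t - 1) + dickman_ratio (t - 1) * (t * dickman t)"
    have d: "((\<lambda>v. dickman (v - 1)) has_real_derivative - (dickman_ratio (t - 1) * dickman (t - 1)) * 1) (at t)"
      by (rule DERIV_chain2[OF has_real_derivative_dickman'])
        (use t that in \<open>auto intro!: derivative_eq_intros\<close>)
    have p: "dickman (t - 1) > 0" using dickman_pos t that by simp
    have "(F has_real_derivative
      ((dickman t - dickman (t - 1)) * dickman (t - 1)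
        - (t * dickman t) * (- (dickman_ratio (t - 1) * dickman (t - 1)) * 1))
        / (dickman (t - 1) * dickman (t - 1))) (at t)"
      unfolding F_def
      by (rule DERIV_divide[OF has_real_derivative_mult_dickman d]) (use t that p in auto)
    moreover have "((dickman t - dickman (t - 1)) * dickman (t - 1)
        - (t * dickman t) * (- (dickman_ratio (t - 1) * dickman (t - 1)) * 1))
        / (dickman (t - 1) * dickman (t - 1)) = ?J / dickman (t - 1)"
      using p by (simp add: field_simps)
    moreover have "?J / dickman (t - 1) < 0"
      using J[of t] t that p by (intro divide_neg_pos) auto
    ultimately show "\<exists>d. (F has_real_derivative d) (at t) \<and> d < 0" by metis
  qed
  have "F y < F x"
  proof -
    consider "y \<le> 2" | "2 \<le> x" | "x < 2" "2 < y" by linarith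
    thus ?thesis
      by cases (use F1[of x y] F2[of x y] F1[of x 2] F2[of 2 y] xy in auto)
  qed
  moreover have "dickman_ratio u = inverse (F u)" for u
    by (simp add: dickman_ratio_def F_def)
  moreover have "F y > 0"
    unfolding F_def using xy by (intro divide_pos_pos mult_pos_pos dickman_pos) auto
  ultimately show ?thesis by (simp add: less_imp_inverse_less)
qed

text \<open>A first-zero argument: negativity of \<open>J\<close> before \<open>z\<close> makes
  \<open>dickman_ratio\<close> increase up to \<open>z\<close>, and this in turn gives
  \<open>J z < 0\<close>.\<close>

lemma dickman_ratio_less:
  assumes "1 \<le> x" "x < y"
  shows "dickman_ratio x < dickman_ratio y"
proof -
  define J where "J t = dickman t - dickman (t - 1) + dickman_ratio (t - 1) * (t * dickman t)" for t
  have contJ: "continuous_on {2..} J"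
  proof -
    have "continuous_on {2..} (\<lambda>t. dickman_ratio (t - 1))"
      by (rule continuous_on_compose2[OF continuous_on_dickman_ratio]) (auto intro!: continuous_intros)
    thus ?thesis unfolding J_def
      by (intro continuous_intros continuous_on_dickman' continuous_on_dickman_shift) auto
  qed
  have step: "J z < 0" if z: "2 \<le> z" and J: "\<And>t. 2 \<le> t \<Longrightarrow> t < z \<Longrightarrow> J t < 0" for z
  proof -
    \<comment> \<open>By \<open>dickman_integral_eq\<close>, \<open>J z = ?g z - ?g (z - 1)\<close>.
      The derivative of \<open>?g\<close> at \<open>t\<close> is
      \<open>(dickman_ratio (z - 1) - dickman_ratio t) * dickman t\<close>.\<close>
    let ?g = "\<lambda>t. dickman_ratio (z - 1) * dickman_prim t + dickman t"
    have "?g z < ?g (z - 1)"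
    proof (rule DERIV_neg_imp_decreasing_open[where f = ?g])
      show "continuous_on {z - 1..z} ?g"
        by (intro continuous_intros continuous_on_dickman' continuous_on_dickman_prim) (use z in auto)
      fix t assume t: "z - 1 < t" "t < z"
      have "dickman_ratio (z - 1) < dickman_ratio t"
        by (rule dickman_ratio_less_aux[of z]) (use J t z in \<open>auto simp: J_def\<close>)
      hence "(dickman_ratio (z - 1) - dickman_ratio t) * dickman t < 0"
        using dickman_pos[of t] t z by (simp add: mult_less_0_iff)
      moreover have "(?g has_real_derivative dickman_ratio (z - 1) * dickman t
          + - (dickman_ratio t * dickman t)) (at t)"
        using t z by (intro DERIV_add DERIV_cmult has_real_derivative_dickman'
            has_real_derivative_dickman_prim) auto
      ultimately show "\<exists>d. (?g has_real_derivative d) (at t) \<and> d < 0"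
        by (intro exI[of _ "dickman_ratio (z - 1) * dickman t + - (dickman_ratio t * dickman t)"])
          (auto simp: algebra_simps)
    qed simp
    moreover have "z * dickman z = dickman_prim z - dickman_prim (z - 1)"
      using dickman_integral_eq z by simp
    hence "dickman_ratio (z - 1) * (z * dickman z)
        = dickman_ratio (z - 1) * dickman_prim z - dickman_ratio (z - 1) * dickman_prim (z - 1)"
      by (simp add: right_diff_distrib)
    ultimately show ?thesis by (simp add: J_def)
  qed
  have neg: "J t < 0" if "t \<ge> 2" for t
  proof (rule ccontr)
    assume *: "\<not> J t < 0"
    define Z where "Z = {2..} \<inter> J -` {0..}"
    have Z: "closed Z" "bdd_below Z" "Z \<noteq> {}"
      unfolding Z_def using * that continuous_closed_preimage[OF contJ]
      by (auto intro!: bdd_belowI[of _ 2])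
    have z: "Inf Z \<in> Z" using closed_contains_Inf[OF Z(3,2,1)] .
    have "J t < 0" if "2 \<le> t" "t < Inf Z" for t
      using that cInf_lower[OF _ Z(2), of t] by (force simp: Z_def)
    with step[of "Inf Z"] z show False by (simp add: Z_def)
  qed
  show ?thesis
    by (rule dickman_ratio_less_aux[of y]) (use neg assms in \<open>auto simp: J_def\<close>)
qed

lemma dickman_ratio_mono: "1 \<le> x \<Longrightarrow> x \<le> y \<Longrightarrow> dickman_ratio x \<le> dickman_ratio y"
  using dickman_ratio_less[of x y] by (cases "x = y") auto

text \<open>The derivative of \<open>ln (dickman t)\<close> is \<open>- dickman_ratio t\<close>,
  which is monotone, so the mean value theorem bounds the change of the logarithm by the values at
  the two ends.\<close>

lemma dickman_exp_bounds:
  assumes "1 \<le> a" "a \<le> b"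
  shows "exp ((b - a) * dickman_ratio a) * dickman b \<le> dickman a"
    and "dickman a \<le> exp ((b - a) * dickman_ratio b) * dickman b"
proof -
  have "(b - a) * dickman_ratio a \<le> ln (dickman a) - ln (dickman b) \<and>
    ln (dickman a) - ln (dickman b) \<le> (b - a) * dickman_ratio b"
  proof (cases "a = b")
    case False
    have cont: "continuous_on {a..b} (\<lambda>t. ln (dickman t))"
      by (intro continuous_intros continuous_on_dickman') (use assms in \<open>auto simp: dickman_nonzero\<close>)
    have deriv: "((\<lambda>t. ln (dickman t)) has_real_derivative - dickman_ratio t) (at t)"
      if "a < t" "t < b" for t
      using DERIV_chain2[OF DERIV_ln_divide[OF dickman_pos] has_real_derivative_dickman', of t]
        dickman_pos[of t] that assms by simp
    obtain t where t: "a < t" "t < b" "ln (dickman b) - ln (dickman a) = (b - a) * - dickman_ratio t"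
    proof -
      have "(\<lambda>t. ln (dickman t)) differentiable (at t)" if "a < t" "t < b" for t
        using deriv[OF that] real_differentiable_def by blast
      then obtain l z where z: "a < z" "z < b" "DERIV (\<lambda>t. ln (dickman t)) z :> l"
          "ln (dickman b) - ln (dickman a) = (b - a) * l"
        using MVT[of a b "\<lambda>t. ln (dickman t)"] cont assms False by auto
      have "l = - dickman_ratio z" using DERIV_unique[OF z(3) deriv] z by simp
      thus ?thesis using that[of z] z by simp
    qed
    have "dickman_ratio a \<le> dickman_ratio t" "dickman_ratio t \<le> dickman_ratio b"
      using t assms by (auto intro!: dickman_ratio_mono)
    hence "(b - a) * dickman_ratio a \<le> (b - a) * dickman_ratio t"
      "(b - a) * dickman_ratio t \<le> (b - a) * dickman_ratio b"
      using assms by (auto intro!: mult_left_mono)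
    thus ?thesis using t(3) by (simp add: algebra_simps)
  qed simp
  hence e: "exp ((b - a) * dickman_ratio a) \<le> exp (ln (dickman a) - ln (dickman b))"
    "exp (ln (dickman a) - ln (dickman b)) \<le> exp ((b - a) * dickman_ratio b)" by simp_all
  have "exp (ln (dickman a) - ln (dickman b)) = dickman a / dickman b"
    using dickman_pos[of a] dickman_pos[of b] assms by (simp add: exp_diff)
  with e show "exp ((b - a) * dickman_ratio a) * dickman b \<le> dickman a"
    "dickman a \<le> exp ((b - a) * dickman_ratio b) * dickman b"
    using dickman_pos[of b] assms by (simp_all add: field_simps)
qed

text \<open>The unit step from \<open>u - 1\<close> to \<open>u\<close> in
  \<open>dickman_exp_bounds\<close> gives \<open>u * R \<le> exp R\<close> for
  \<open>R = dickman_ratio u\<close>, and \<open>R \<ge> 1\<close>.\<close>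

lemma dickman_ratio_ge_ln:
  assumes "u \<ge> 2"
  shows "ln u \<le> dickman_ratio u"
proof -
  have "u * dickman_ratio u * dickman u \<le> exp (dickman_ratio u) * dickman u"
    using dickman_exp_bounds(2)[of "u - 1" u] dickman_minus_1[of u] assms by simp
  hence "u * dickman_ratio u \<le> exp (dickman_ratio u)"
    using dickman_pos[of u] assms by simp
  moreover have "u * 1 \<le> u * dickman_ratio u"
    using dickman_ratio_ge_1[of u] assms by (intro mult_left_mono) auto
  ultimately have "u \<le> exp (dickman_ratio u)" by simp
  hence "ln u \<le> ln (exp (dickman_ratio u))" using assms by (subst ln_le_cancel_iff) auto
  thus ?thesis by simp
qed

text \<open>The unit step from \<open>u\<close> to \<open>u + 1\<close> loses at least the factor
  \<open>exp (dickman_ratio u)\<close>, but by \<open>dickman_shift_le\<close> at most a quadratic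
  one.\<close>

lemma dickman_ratio_le_ln:
  assumes "u \<ge> 1"
  shows "dickman_ratio u \<le> ln (4 * (u + 1)\<^sup>2)"
proof -
  have "exp (dickman_ratio u) * dickman (u + 1) \<le> 4 * (u + 1)\<^sup>2 * dickman (u + 1)"
    using dickman_exp_bounds(1)[of u "u + 1"] dickman_shift_le[of "u + 1"] assms by simp
  hence "exp (dickman_ratio u) \<le> 4 * (u + 1)\<^sup>2"
    using dickman_pos[of "u + 1"] assms by simp
  thus ?thesis using assms by (subst ln_ge_iff) auto
qed

text \<open>By \<open>dickman_mult_le\<close> each unit step divides by at least the new argument,
  which is at least 2.\<close>

lemma dickman_add_nat_le:
  assumes "x \<ge> 1"
  shows "dickman (x + real k) \<le> dickman x / 2 ^ k"
proof (induction k)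
  case (Suc k)
  have "2 * dickman (x + real k + 1) \<le> (x + real k + 1) * dickman (x + real k + 1)"
    using assms dickman_pos[of "x + real k + 1"] by (intro mult_right_mono) auto
  also have "\<dots> \<le> dickman (x + real k)"
    using dickman_mult_le[of "x + real k + 1"] assms by simp
  also have "\<dots> \<le> dickman x / 2 ^ k" by (rule Suc.IH)
  finally show ?case by (simp add: field_simps)
qed simp

section \<open>The derivative of Buchstab's function\<close>

text \<open>
  In \<open>v f(v) = \<sigma> (P(v) - P(v - 1))\<close>, \<open>\<sigma> = 1\<close> is Dickman's case and \<open>\<sigma> = -1\<close> that of \<open>f = \<omega>'\<close>. Substituting
  the relation into itself twice gives the two logarithmic kernels; a third substitution is applied
  only to the part \<open>(t - 1)(t - u + 1)/(2u\<^sup>2)\<close> of the second one. The terms with the factor \<open>\<sigma>\<close> result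
  from the third substitution.
\<close>

lemma delay_kernel_integral:
  fixes f P :: "real \<Rightarrow> real"
  assumes u: "u > a + 3" "a \<ge> 0" and \<sigma>: "\<sigma> * \<sigma> = 1"
    and P: "\<And>x. x > a \<Longrightarrow> (P has_real_derivative f x) (at x)"
    and f: "\<And>v. v > a + 1 \<Longrightarrow> v * f v = \<sigma> * (P v - P (v - 1))"
  shows "((\<lambda>t. ln (u / t) * f t
      + (ln (t / (u - 1)) - (t - 1) * ((t - u + 1) / (2 * u\<^sup>2)) + \<sigma> * ((1 - (t - u + 1)\<^sup>2) / (4 * u\<^sup>2))) * f (t - 1)
      + \<sigma> * ((t - u + 1)\<^sup>2 / (4 * u\<^sup>2)) * f (t - 2)) has_integral u * f u) {u - 1..u}"
proof -
  \<comment> \<open>\<open>W\<close> is an antiderivative of the integrand. The two logarithmic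
    terms have the same sum at both ends, and so do the two quadratic ones; only
    \<open>\<sigma> * P t\<close> contributes to \<open>W u - W (u - 1)\<close>.\<close>
  define W where "W t = ln (u / t) * P t + ln (t / (u - 1)) * P (t - 1)
    + \<sigma> * ((1 - (t - u + 1)\<^sup>2) / (4 * u\<^sup>2) * P (t - 1) + (t - u + 1)\<^sup>2 / (4 * u\<^sup>2) * P (t - 2))
    + \<sigma> * P t" for t
  have P1: "((\<lambda>t. P (t - c)) has_real_derivative f (t - c)) (at t)" if "t - c > a" for t c
  proof -
    have "((\<lambda>t. t - c) has_real_derivative 1) (at t)" by (auto intro!: derivative_eq_intros)
    from DERIV_chain2[OF P[OF that] this] show ?thesis by simp
  qed
  have "((\<lambda>t. ln (u / t) * f t
      + (ln (t / (u - 1)) - (t - 1) * ((t - u + 1) / (2 * u\<^sup>2)) + \<sigma> * ((1 - (t - u + 1)\<^sup>2) / (4 * u\<^sup>2))) * f (t - 1)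
      + \<sigma> * ((t - u + 1)\<^sup>2 / (4 * u\<^sup>2)) * f (t - 2)) has_integral W u - W (u - 1)) {u - 1..u}"
  proof (rule fundamental_theorem_of_calculus)
    fix t assume t: "t \<in> {u - 1..u}"
    have t0: "t > 1" "u > 1" using t u by auto
    have e1: "\<sigma> * (P t - P (t - 1)) = t * f t" "\<sigma> * (P (t - 1) - P (t - 2)) = (t - 1) * f (t - 1)"
      using f[of t] f[of "t - 1"] t u by (auto simp: algebra_simps)
    have "P t - P (t - 1) = \<sigma> * (t * f t)"
      unfolding e1(1)[symmetric] using \<sigma> by (simp flip: mult.assoc)
    hence e2: "(P t - P (t - 1)) / t = \<sigma> * f t" using t0 by simp
    have "((\<lambda>t. ln (u / t) * P t) has_real_derivative ln (u / t) * f t - P t / t) (at t)"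
      using P[of t] t u t0 by (auto intro!: derivative_eq_intros simp: field_simps)
    moreover have "((\<lambda>t. ln (t / (u - 1)) * P (t - 1)) has_real_derivative
        ln (t / (u - 1)) * f (t - 1) + P (t - 1) / t) (at t)"
    proof -
      have "((\<lambda>t. ln (t / w)) has_real_derivative 1 / t) (at t)" if "w > 0" for w
        using t0 that by (auto intro!: derivative_eq_intros simp: field_simps)
      from DERIV_mult[OF this[of "u - 1"] P1[of t 1]] show ?thesis
        using t0 t u by (simp add: add.commute mult.commute)
    qed
    moreover have "((\<lambda>t. (1 - (t - u + 1)\<^sup>2) / (4 * u\<^sup>2) * P (t - 1)) has_real_derivative
        (1 - (t - u + 1)\<^sup>2) / (4 * u\<^sup>2) * f (t - 1) - (t - u + 1) / (2 * u\<^sup>2) * P (t - 1)) (at t)"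
      using P1[of t 1] t u t0 by (auto intro!: derivative_eq_intros simp: field_simps)
    moreover have "((\<lambda>t. (t - u + 1)\<^sup>2 / (4 * u\<^sup>2) * P (t - 2)) has_real_derivative
        (t - u + 1)\<^sup>2 / (4 * u\<^sup>2) * f (t - 2) + (t - u + 1) / (2 * u\<^sup>2) * P (t - 2)) (at t)"
      using P1[of t 2] t u t0 by (auto intro!: derivative_eq_intros simp: field_simps)
    moreover have "(P has_real_derivative f t) (at t)" using P[of t] t u by simp
    ultimately have "(W has_real_derivative ln (u / t) * f t - P t / t
        + (ln (t / (u - 1)) * f (t - 1) + P (t - 1) / t)
        + \<sigma> * ((1 - (t - u + 1)\<^sup>2) / (4 * u\<^sup>2) * f (t - 1) - (t - u + 1) / (2 * u\<^sup>2) * P (t - 1)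
          + ((t - u + 1)\<^sup>2 / (4 * u\<^sup>2) * f (t - 2) + (t - u + 1) / (2 * u\<^sup>2) * P (t - 2)))
        + \<sigma> * f t) (at t)"
      unfolding W_def by (intro DERIV_add DERIV_cmult)
    also have "ln (u / t) * f t - P t / t
        + (ln (t / (u - 1)) * f (t - 1) + P (t - 1) / t)
        + \<sigma> * ((1 - (t - u + 1)\<^sup>2) / (4 * u\<^sup>2) * f (t - 1) - (t - u + 1) / (2 * u\<^sup>2) * P (t - 1)
          + ((t - u + 1)\<^sup>2 / (4 * u\<^sup>2) * f (t - 2) + (t - u + 1) / (2 * u\<^sup>2) * P (t - 2)))
        + \<sigma> * f t
      = ln (u / t) * f t + ln (t / (u - 1)) * f (t - 1) - ((P t - P (t - 1)) / t - \<sigma> * f t)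
        - (t - u + 1) / (2 * u\<^sup>2) * (\<sigma> * (P (t - 1) - P (t - 2)))
        + \<sigma> * ((1 - (t - u + 1)\<^sup>2) / (4 * u\<^sup>2)) * f (t - 1) + \<sigma> * ((t - u + 1)\<^sup>2 / (4 * u\<^sup>2)) * f (t - 2)"
    proof -
      have "L * f0 - p0 / t + (M * f1 + p1 / t) + \<sigma> * (Y * f1 - X * p1 + (Z * f2 + X * p2)) + \<sigma> * f0
        = L * f0 + M * f1 - ((p0 - p1) / t - \<sigma> * f0) - X * (\<sigma> * (p1 - p2)) + \<sigma> * Y * f1 + \<sigma> * Z * f2"
        for L M X Y Z f0 f1 f2 p0 p1 p2 :: real by (simp add: algebra_simps diff_divide_distrib)
      thus ?thesis .
    qed
    also have "\<dots> = ln (u / t) * f t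
      + (ln (t / (u - 1)) - (t - 1) * ((t - u + 1) / (2 * u\<^sup>2)) + \<sigma> * ((1 - (t - u + 1)\<^sup>2) / (4 * u\<^sup>2))) * f (t - 1)
      + \<sigma> * ((t - u + 1)\<^sup>2 / (4 * u\<^sup>2)) * f (t - 2)"
    proof -
      have "A + B * g - (b - b) - X * (c * g) + \<sigma> * Y * g + Z = A + (B - c * X + \<sigma> * Y) * g + Z"
        for A B b X c g Y Z :: real by (simp add: algebra_simps)
      thus ?thesis unfolding e1(2) e2 .
    qed
    finally show "(W has_vector_derivative ln (u / t) * f t
      + (ln (t / (u - 1)) - (t - 1) * ((t - u + 1) / (2 * u\<^sup>2)) + \<sigma> * ((1 - (t - u + 1)\<^sup>2) / (4 * u\<^sup>2))) * f (t - 1)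
      + \<sigma> * ((t - u + 1)\<^sup>2 / (4 * u\<^sup>2)) * f (t - 2)) (at t within {u - 1..u})"
      by (simp add: has_real_derivative_iff_has_vector_derivative has_vector_derivative_at_within)
  qed simp
  also have "W u - W (u - 1) = \<sigma> * (P u - P (u - 1))"
    using u by (simp add: W_def algebra_simps)
  also have "\<dots> = u * f u" using f[of u] u by simp
  finally show ?thesis .
qed

text \<open>
  Compared with the identity for \<open>dickman\<close>, the bound gains twice the term \<open>(1 - (t - u + 1)\<^sup>2)/(4u\<^sup>2)\<close>
  wherever the kernel at \<open>t - 1\<close> stays nonnegative. The bulk of that gain lies at
  \<open>t - u + 1\<close> of order \<open>1 / dickman_ratio u\<close>.
\<close>

lemma delay_kernel_contraction:
  fixes f P :: "real \<Rightarrow> real"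
  assumes u: "u > 5" and R: "4 \<le> dickman_ratio u" "dickman_ratio u \<le> 2 * u"
    and P: "\<And>x. x > 2 \<Longrightarrow> (P has_real_derivative f x) (at x)"
    and f: "\<And>v. v > 3 \<Longrightarrow> v * f v = - (P v - P (v - 1))"
    and M: "M \<ge> 0" "\<And>x. u - 3 \<le> x \<Longrightarrow> x \<le> u \<Longrightarrow> \<bar>f x\<bar> \<le> M * dickman x"
  shows "\<bar>f u\<bar> \<le> M * dickman u * (1 - 3 / (8 * exp 2) * (u - 1) * dickman_ratio (u - 1) / u\<^sup>2)"
proof -
  \<comment> \<open>The gain is collected for \<open>t - u + 1\<close> in
    \<open>[\<delta>, 2 * \<delta>]\<close>. The lower bound on \<open>\<delta>\<close> makes the
    kernel at \<open>t - 1\<close> nonnegative there, and \<open>2 * \<delta> \<le> 1/2\<close>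
    keeps \<open>\<Phi>\<close> above 3/4 of its maximum. On the scale
    \<open>1 / dickman_ratio u\<close>, \<open>dickman\<close> changes by a bounded factor
    only.\<close>
  define \<delta> where "\<delta> = 1 / dickman_ratio u"
  have \<delta>: "0 < \<delta>" "1 / (2 * u) \<le> \<delta>" "\<delta> \<le> 1/4"
    using R u by (auto simp: \<delta>_def field_simps)
  define \<Phi> where "\<Phi> t = (1 - (t - u + 1)\<^sup>2) / (4 * u\<^sup>2)" for t
  define k where "k t = ln (t / (u - 1)) - (t - 1) * ((t - u + 1) / (2 * u\<^sup>2))" for t
  define c where "c = 3 / (8 * u\<^sup>2) * dickman (u - 2 + 2 * \<delta>)"
  define g where "g t = (if t \<in> {u - 1 + \<delta>..u - 1 + 2 * \<delta>} then c else 0)" for t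
  \<comment> \<open>\<open>F\<close> and \<open>D\<close> are the integrands of
    \<open>delay_kernel_integral\<close> for \<open>\<sigma> = -1\<close> and
    \<open>\<sigma> = 1\<close>.\<close>
  define F where "F t = ln (u / t) * f t + (k t + (-1) * \<Phi> t) * f (t - 1)
    + (-1) * ((t - u + 1)\<^sup>2 / (4 * u\<^sup>2)) * f (t - 2)" for t
  define D where "D t = ln (u / t) * dickman t + (k t + 1 * \<Phi> t) * dickman (t - 1)
    + 1 * ((t - u + 1)\<^sup>2 / (4 * u\<^sup>2)) * dickman (t - 2)" for t
  have F: "(F has_integral u * f u) {u - 1..u}"
    unfolding F_def k_def \<Phi>_def
    by (rule delay_kernel_integral[where P = P and a = 2]) (use u P f in auto)
  have D: "(D has_integral u * dickman u) {u - 1..u}"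
    unfolding D_def k_def \<Phi>_def
    by (rule delay_kernel_integral[where P = dickman_prim and a = 0])
      (use u has_real_derivative_dickman_prim dickman_integral_eq in auto)
  have g: "(g has_integral c * \<delta>) {u - 1..u}"
  proof -
    have "((\<lambda>t. c) has_integral c * \<delta>) {u - 1 + \<delta>..u - 1 + 2 * \<delta>}"
      using has_integral_const_real[of c "u - 1 + \<delta>" "u - 1 + 2 * \<delta>"] \<delta> by (simp add: mult.commute)
    thus ?thesis
      unfolding g_def by (subst has_integral_restrict) (use \<delta> in auto)
  qed
  have le: "\<bar>F t\<bar> \<le> M * (D t - g t)" if t: "t \<in> {u - 1..u}" for t
  proof -
    let ?s = "t - u + 1"
    have s: "0 \<le> ?s" "?s \<le> 1" using t by auto
    have l1: "ln (u / t) \<ge> 0" using t u by simp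
    \<comment> \<open>The logarithm is at least \<open>?s / u\<close>, and the subtracted term takes
      away at most half of this.\<close>
    have "?s / (2 * u) \<le> k t"
    proof -
      have "1 - (u - 1) / t \<le> ln (t / (u - 1))"
        using ln_le_minus_one[of "(u - 1) / t"] t u by (simp add: ln_div)
      moreover have "1 - (u - 1) / t = ?s / t" using t u by (simp add: field_simps)
      moreover have "?s / u \<le> ?s / t" using t u s by (intro divide_left_mono) auto
      moreover have "(t - 1) * (?s / (2 * u\<^sup>2)) \<le> u * (?s / (2 * u\<^sup>2))"
        using t u s by (intro mult_right_mono) auto
      moreover have "u * (?s / (2 * u\<^sup>2)) = ?s / (2 * u)"
        using u by (simp add: field_simps power2_eq_square)
      moreover have "?s / u = ?s / (2 * u) + ?s / (2 * u)" using u by (simp add: field_simps)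
      ultimately show ?thesis unfolding k_def by linarith
    qed
    hence k0: "k t \<ge> 0" using s u by (smt (verit) divide_nonneg_pos)
    have s2: "?s\<^sup>2 \<le> 1" using s by (simp add: power_le_one)
    have \<Phi>0: "0 \<le> \<Phi> t" unfolding \<Phi>_def using s2 by simp
    have k\<Phi>: "\<Phi> t \<le> k t" if "t \<in> {u - 1 + \<delta>..u - 1 + 2 * \<delta>}"
    proof -
      have "1 / (2 * u) / (2 * u) \<le> ?s / (2 * u)"
        using that \<delta> u by (intro divide_right_mono) auto
      moreover have "\<Phi> t \<le> 1 / (4 * u\<^sup>2)" unfolding \<Phi>_def by (intro divide_right_mono) auto
      moreover have "1 / (2 * u) / (2 * u) = 1 / (4 * u\<^sup>2)" by (simp add: power2_eq_square)
      ultimately show ?thesis using \<open>?s / (2 * u) \<le> k t\<close> by linarith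
    qed
    have gl: "g t \<le> 2 * \<Phi> t * dickman (t - 1)" if "t \<in> {u - 1 + \<delta>..u - 1 + 2 * \<delta>}"
    proof -
      have "?s \<le> 1/2" using that \<delta> by auto
      hence "?s\<^sup>2 \<le> (1/2)\<^sup>2" using s by (intro power_mono) auto
      hence "?s\<^sup>2 \<le> 1/4" by (simp add: power2_eq_square)
      hence "(3/4) / (4 * u\<^sup>2) \<le> \<Phi> t" unfolding \<Phi>_def by (intro divide_right_mono) auto
      hence "3 / (8 * u\<^sup>2) \<le> 2 * \<Phi> t" by simp
      moreover have "dickman (u - 2 + 2 * \<delta>) \<le> dickman (t - 1)"
        using that u \<delta> by (intro dickman_antimono) auto
      ultimately have "c \<le> 2 * \<Phi> t * dickman (t - 1)"
        unfolding c_def using \<Phi>0 dickman_pos[of "u - 2 + 2 * \<delta>"] u \<delta> by (intro mult_mono) auto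
      thus ?thesis using that by (simp add: g_def)
    qed
    \<comment> \<open>On the window \<open>k t - \<Phi> t\<close> is nonnegative and falls short of
      \<open>k t + \<Phi> t\<close> by \<open>2 * \<Phi> t\<close>; elsewhere the triangle
      inequality suffices.\<close>
    have kk: "\<bar>k t + (-1) * \<Phi> t\<bar> * dickman (t - 1) \<le> (k t + \<Phi> t) * dickman (t - 1) - g t"
    proof (cases "t \<in> {u - 1 + \<delta>..u - 1 + 2 * \<delta>}")
      case True
      thus ?thesis using k\<Phi> gl by (simp add: algebra_simps)
    next
      case False
      have "\<bar>k t + (-1) * \<Phi> t\<bar> \<le> k t + \<Phi> t" using k0 \<Phi>0 by auto
      hence "\<bar>k t + (-1) * \<Phi> t\<bar> * dickman (t - 1) \<le> (k t + \<Phi> t) * dickman (t - 1)"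
        using dickman_pos[of "t - 1"] t u by (intro mult_right_mono) auto
      moreover have "g t = 0" using False unfolding g_def by (rule if_not_P)
      ultimately show ?thesis by simp
    qed
    have "\<bar>F t\<bar> \<le> \<bar>ln (u / t) * f t\<bar> + \<bar>(k t + (-1) * \<Phi> t) * f (t - 1)\<bar>
        + \<bar>(-1) * (?s\<^sup>2 / (4 * u\<^sup>2)) * f (t - 2)\<bar>"
      unfolding F_def by linarith
    also have "\<dots> = ln (u / t) * \<bar>f t\<bar> + \<bar>k t + (-1) * \<Phi> t\<bar> * \<bar>f (t - 1)\<bar>
        + ?s\<^sup>2 / (4 * u\<^sup>2) * \<bar>f (t - 2)\<bar>"
      using l1 by (simp add: abs_mult)
    also have "\<dots> \<le> ln (u / t) * (M * dickman t) + \<bar>k t + (-1) * \<Phi> t\<bar> * (M * dickman (t - 1))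
        + ?s\<^sup>2 / (4 * u\<^sup>2) * (M * dickman (t - 2))"
      using t u l1 by (intro add_mono mult_left_mono M) auto
    also have "\<dots> = M * (ln (u / t) * dickman t + \<bar>k t + (-1) * \<Phi> t\<bar> * dickman (t - 1)
        + ?s\<^sup>2 / (4 * u\<^sup>2) * dickman (t - 2))"
      by (simp only: distrib_left mult_ac)
    also have "\<dots> \<le> M * (ln (u / t) * dickman t + ((k t + \<Phi> t) * dickman (t - 1) - g t)
        + ?s\<^sup>2 / (4 * u\<^sup>2) * dickman (t - 2))"
      by (intro mult_left_mono add_mono kk order_refl M)
    also have "\<dots> = M * (D t - g t)" by (simp add: D_def)
    finally show ?thesis .
  qed
  have G: "((\<lambda>t. M * (D t - g t)) has_integral M * (u * dickman u - c * \<delta>)) {u - 1..u}"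
    by (intro has_integral_mult_right has_integral_diff D g)
  have "norm (integral {u - 1..u} F) \<le> integral {u - 1..u} (\<lambda>t. M * (D t - g t))"
    by (rule integral_norm_bound_integral) (use F G le in \<open>auto intro: has_integral_integrable\<close>)
  hence 1: "\<bar>u * f u\<bar> \<le> M * (u * dickman u - c * \<delta>)"
    unfolding integral_unique[OF F] integral_unique[OF G] by simp
  have "dickman (u - 2) \<le> exp 2 * dickman (u - 2 + 2 * \<delta>)"
  proof -
    have "dickman (u - 2) \<le> exp ((u - 2 + 2 * \<delta> - (u - 2)) * dickman_ratio (u - 2 + 2 * \<delta>)) * dickman (u - 2 + 2 * \<delta>)"
      using \<delta> u by (intro dickman_exp_bounds) auto
    also have "(u - 2 + 2 * \<delta> - (u - 2)) * dickman_ratio (u - 2 + 2 * \<delta>) \<le> 2 * \<delta> * dickman_ratio u"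
      using \<delta> u by (auto intro!: mult_left_mono dickman_ratio_mono)
    also have "2 * \<delta> * dickman_ratio u = 2" using R by (simp add: \<delta>_def)
    finally show ?thesis using dickman_pos[of "u - 2 + 2 * \<delta>"] u \<delta> by simp
  qed
  hence "3 / (8 * u\<^sup>2) * (dickman (u - 2) / exp 2) * \<delta> \<le> c * \<delta>"
    unfolding c_def using \<delta> by (intro mult_right_mono mult_left_mono) (auto simp: field_simps)
  \<comment> \<open>Two unit steps produce the factors \<open>dickman_ratio (u - 1)\<close> and
    \<open>dickman_ratio u\<close>; the latter cancels against \<open>\<delta>\<close>.\<close>
  moreover have "dickman (u - 2) = (u - 1) * dickman_ratio (u - 1) * (u * dickman_ratio u * dickman u)"
    using dickman_minus_1[of "u - 1"] dickman_minus_1[of u] u by simp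
  moreover have "3 / (8 * u\<^sup>2) * ((u - 1) * dickman_ratio (u - 1) * (u * dickman_ratio u * dickman u) / exp 2) * \<delta>
     = u * dickman u * (3 / (8 * exp 2) * (u - 1) * dickman_ratio (u - 1) / u\<^sup>2)"
  proof -
    have "3 / (8 * w) * (a * b * (u * r * d) / e) * (1 / r) = u * d * (3 / (8 * e) * a * b / w)"
      if "r \<noteq> 0" for w a b r d e :: real using that by (simp add: mult_ac)
    thus ?thesis unfolding \<delta>_def using R by fastforce
  qed
  ultimately have "u * dickman u * (3 / (8 * exp 2) * (u - 1) * dickman_ratio (u - 1) / u\<^sup>2) \<le> c * \<delta>"
    by simp
  hence "M * (u * dickman u - c * \<delta>)
    \<le> M * (u * dickman u - u * dickman u * (3 / (8 * exp 2) * (u - 1) * dickman_ratio (u - 1) / u\<^sup>2))"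
    using M(1) by (intro mult_left_mono) auto
  also have "\<dots> = u * (M * dickman u * (1 - 3 / (8 * exp 2) * (u - 1) * dickman_ratio (u - 1) / u\<^sup>2))"
    by (simp add: algebra_simps)
  finally have "\<bar>u * f u\<bar> \<le> u * (M * dickman u * (1 - 3 / (8 * exp 2) * (u - 1) * dickman_ratio (u - 1) / u\<^sup>2))"
    using 1 by (rule order_trans[rotated])
  moreover have "\<bar>u * f u\<bar> = u * \<bar>f u\<bar>" using u by (simp add: abs_mult)
  ultimately show ?thesis using u by (simp only: mult_le_cancel_left_pos)
qed

section \<open>Decay of the derivative of Buchstab's function\<close>

lemma continuous_on_buchstab: "A \<subseteq> {1..} \<Longrightarrow> continuous_on A buchstab"
  and buchstab_eq_inverse: "1 \<le> v \<Longrightarrow> v \<le> 2 \<Longrightarrow> buchstab v = 1 / v"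
  and has_real_derivative_mult_buchstab:
    "v > 2 \<Longrightarrow> ((\<lambda>u. u * buchstab u) has_real_derivative buchstab (v - 1)) (at v)"
  using is_buchstab_buchstab by (auto simp: is_buchstab_def intro: continuous_on_subset)

lemma has_real_derivative_buchstab:
  assumes "v > 2"
  shows "(buchstab has_real_derivative (buchstab (v - 1) - buchstab v) / v) (at v)"
proof -
  have "((\<lambda>u. u * buchstab u / u) has_real_derivative
      (buchstab (v - 1) * v - v * buchstab v * 1) / (v * v)) (at v)"
    by (rule DERIV_divide[OF has_real_derivative_mult_buchstab[OF assms] DERIV_ident]) (use assms in auto)
  moreover have "(buchstab (v - 1) * v - v * buchstab v * 1) / (v * v) = (buchstab (v - 1) - buchstab v) / v"
    using assms by (simp add: field_simps)
  ultimately show ?thesis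
    by (auto intro: has_field_derivative_transform_within_open[of _ _ _ "{2<..}"] simp: assms)
qed

text \<open>A maximum argument for the quotient \<open>q\<close>: at a maximiser beyond
  \<open>U\<close> the contraction gains a relative amount of order \<open>ln u / u\<close>, which
  beats the loss \<open>(u / (u - 3)) ^ 4 = 1 + O(1/u)\<close> from freezing the weight. Such a
  maximiser has \<open>q = 0\<close>, so the maximum over \<open>{2..U}\<close> is global.\<close>

lemma buchstab_deriv_bound_ge_2:
  obtains B where "B \<ge> 0"
    "\<And>v. v \<ge> 2 \<Longrightarrow> \<bar>(buchstab (v - 1) - buchstab v) / v\<bar> \<le> B * dickman v / v ^ 4"
proof -
  define h where "h v = (buchstab (v - 1) - buchstab v) / v" for v
  define q where "q v = \<bar>h v\<bar> * v ^ 4 / dickman v" for v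
  let ?\<theta> = "\<lambda>u::real. 3 / (8 * exp 2) * (u - 1) * ln (u - 1) / u\<^sup>2"
  have "continuous_on {2..} (\<lambda>v. buchstab (v - 1))"
    by (rule continuous_on_compose2[OF continuous_on_buchstab[of "{1..}"]]) (auto intro!: continuous_intros)
  hence "continuous_on {2..} q"
    unfolding q_def h_def
    by (intro continuous_intros continuous_on_buchstab continuous_on_dickman')
      (auto simp: dickman_nonzero)
  hence contq: "continuous_on {2..x} q" for x
    by (rule continuous_on_subset) auto
  have q0: "q v \<ge> 0" if "v \<ge> 2" for v
    unfolding q_def using dickman_pos[of v] that by (intro divide_nonneg_pos mult_nonneg_nonneg) auto
  have hq: "\<bar>h v\<bar> = q v * dickman v / v ^ 4" if "v \<ge> 2" for v
    using dickman_nonzero[of v] that by (simp add: q_def)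
  have "eventually (\<lambda>u::real. (u / (u - 3)) ^ 4 * (1 - ?\<theta> u) < 1) at_top"
    by real_asymp
  moreover have "eventually (\<lambda>u::real. ln u \<ge> 4) at_top" by real_asymp
  moreover have "eventually (\<lambda>u::real. ln (4 * (u + 1)\<^sup>2) \<le> 2 * u) at_top" by real_asymp
  ultimately have "eventually (\<lambda>u::real. (u / (u - 3)) ^ 4 * (1 - ?\<theta> u) < 1 \<and> ln u \<ge> 4
      \<and> ln (4 * (u + 1)\<^sup>2) \<le> 2 * u) at_top"
    by eventually_elim simp
  then obtain U' where U': "\<And>u. u \<ge> U' \<Longrightarrow> (u / (u - 3)) ^ 4 * (1 - ?\<theta> u) < 1 \<and> ln u \<ge> 4
      \<and> ln (4 * (u + 1)\<^sup>2) \<le> 2 * u"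
    unfolding eventually_at_top_linorder by blast
  define U where "U = max U' 6"
  have "\<exists>m\<in>{2..U}. \<forall>y\<in>{2..U}. q y \<le> q m"
    by (rule continuous_attains_sup) (auto simp: U_def contq)
  then obtain m where m: "m \<in> {2..U}" "\<And>y. y \<in> {2..U} \<Longrightarrow> q y \<le> q m" by blast
  have main: "q x \<le> q m" if x2: "x \<ge> 2" for x
  proof -
    have "\<exists>y\<in>{2..x}. \<forall>t\<in>{2..x}. q t \<le> q y"
      by (rule continuous_attains_sup) (use x2 contq in auto)
    then obtain y where y: "y \<in> {2..x}" "\<And>t. t \<in> {2..x} \<Longrightarrow> q t \<le> q y" by blast
    have "q y \<le> q m"
    proof (cases "y \<le> U")
      case True
      thus ?thesis using m y by auto
    next
      case False
      hence yU: "y > 6" "y \<ge> U'" by (auto simp: U_def)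
      have qy: "q y \<ge> 0" using q0 y by auto
      \<comment> \<open>On \<open>[y - 3, y]\<close> maximality of \<open>q y\<close> allows the
        constant \<open>M = q y / (y - 3) ^ 4\<close>; \<open>y > 6\<close> keeps this interval
        inside \<open>{2..x}\<close>.\<close>
      have "\<bar>h y\<bar> \<le> q y / (y - 3) ^ 4 * dickman y
          * (1 - 3 / (8 * exp 2) * (y - 1) * dickman_ratio (y - 1) / y\<^sup>2)"
      proof (rule delay_kernel_contraction[where P = buchstab])
        show "(buchstab has_real_derivative h v) (at v)" if "v > 2" for v
          unfolding h_def using has_real_derivative_buchstab[OF that] .
        show "v * h v = - (buchstab v - buchstab (v - 1))" if "v > 3" for v
          using that by (simp add: h_def)
        show "4 \<le> dickman_ratio y" "dickman_ratio y \<le> 2 * y"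
          using U'[OF yU(2)] dickman_ratio_ge_ln[of y] dickman_ratio_le_ln[of y] yU by auto
        fix v assume v: "y - 3 \<le> v" "v \<le> y"
        have "\<bar>h v\<bar> = q v * dickman v / v ^ 4" using hq v yU by simp
        also have "\<dots> \<le> q y * dickman v / (y - 3) ^ 4"
          using v yU y(2)[of v] y(1) dickman_pos[of v] q0[of v]
          by (intro frac_le mult_right_mono mult_nonneg_nonneg power_mono) auto
        finally show "\<bar>h v\<bar> \<le> q y / (y - 3) ^ 4 * dickman v" by simp
      qed (use yU qy in auto)
      also have "\<dots> \<le> q y / (y - 3) ^ 4 * dickman y * (1 - ?\<theta> y)"
        using dickman_ratio_ge_ln[of "y - 1"] yU qy dickman_pos[of y]
        by (intro mult_left_mono diff_left_mono divide_right_mono) auto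
      finally have "\<bar>h y\<bar> * (y ^ 4 / dickman y) \<le> q y / (y - 3) ^ 4 * dickman y * (1 - ?\<theta> y) * (y ^ 4 / dickman y)"
        using yU dickman_pos[of y] by (intro mult_right_mono) auto
      hence "q y \<le> q y * ((y / (y - 3)) ^ 4 * (1 - ?\<theta> y))"
        using dickman_pos[of y] yU by (simp add: q_def power_divide mult_ac)
      moreover have "q y * ((y / (y - 3)) ^ 4 * (1 - ?\<theta> y)) < q y" if "q y > 0"
        using U'[OF yU(2)] that by simp
      ultimately have "q y = 0" using qy by linarith
      thus ?thesis using q0[of m] m(1) by auto
    qed
    thus ?thesis using y(2)[of x] x2 by auto
  qed
  show ?thesis
  proof
    show "q m \<ge> 0" using q0 m(1) by auto
    fix v :: real assume v: "v \<ge> 2"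
    have "\<bar>h v\<bar> \<le> q m * dickman v / v ^ 4"
      unfolding hq[OF v] using main[OF v] dickman_pos[of v] v
      by (intro divide_right_mono mult_right_mono) auto
    thus "\<bar>(buchstab (v - 1) - buchstab v) / v\<bar> \<le> q m * dickman v / v ^ 4" by (simp add: h_def)
  qed
qed

text \<open>The point 2 is excluded because \<open>buchstab\<close> has a kink there, with one-sided
  derivatives \<open>-1/4\<close> and \<open>1/4\<close>.\<close>

lemma buchstab_deriv_bound:
  obtains B where "B > 0" "\<And>v. v > 1 \<Longrightarrow> v \<noteq> 2 \<Longrightarrow>
    \<exists>d. (buchstab has_real_derivative d) (at v) \<and> \<bar>d\<bar> \<le> B * dickman v / v ^ 4"
proof -
  obtain B where B: "B \<ge> 0"
    "\<And>v. v \<ge> 2 \<Longrightarrow> \<bar>(buchstab (v - 1) - buchstab v) / v\<bar> \<le> B * dickman v / v ^ 4"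
    by (rule buchstab_deriv_bound_ge_2) blast
  \<comment> \<open>\<open>4 / dickman 2\<close> serves the range below 2, where
    \<open>v ^ 2 \<le> 4\<close> and \<open>dickman v \<ge> dickman 2\<close>.\<close>
  define B' where "B' = max B (4 / dickman 2)"
  show ?thesis
  proof
    show "B' > 0" unfolding B'_def using dickman_pos[of 2] by (simp add: less_max_iff_disj)
    fix v :: real assume v: "v > 1" "v \<noteq> 2"
    show "\<exists>d. (buchstab has_real_derivative d) (at v) \<and> \<bar>d\<bar> \<le> B' * dickman v / v ^ 4"
    proof (cases "v > 2")
      case True
      have "B * dickman v / v ^ 4 \<le> B' * dickman v / v ^ 4"
        using dickman_pos[of v] True by (intro divide_right_mono mult_right_mono) (auto simp: B'_def)
      thus ?thesis using has_real_derivative_buchstab[OF True] B(2)[of v] True by fastforce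
    next
      case False
      hence v2: "v < 2" using v by simp
      have "((\<lambda>v. 1 / v) has_real_derivative - (1 / v\<^sup>2)) (at v)"
        using v by (auto intro!: derivative_eq_intros simp: power2_eq_square)
      hence "(buchstab has_real_derivative - (1 / v\<^sup>2)) (at v)"
        by (rule has_field_derivative_transform_within_open[of _ _ _ "{1<..<2}"])
          (use v v2 in \<open>auto simp: buchstab_eq_inverse\<close>)
      moreover have "\<bar>- (1 / v\<^sup>2)\<bar> \<le> B' * dickman v / v ^ 4"
      proof -
        have "v\<^sup>2 \<le> 2\<^sup>2" using v v2 by (intro power_mono) auto
        also have "2\<^sup>2 = 4 / dickman 2 * dickman 2" using dickman_pos[of 2] by simp
        also have "\<dots> \<le> B' * dickman v"
          using dickman_antimono[of v 2] v v2 dickman_pos[of 2] \<open>B' > 0\<close>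
          by (intro mult_mono) (auto simp: B'_def)
        finally have "v\<^sup>2 / v ^ 4 \<le> B' * dickman v / v ^ 4"
          using v by (intro divide_right_mono) auto
        moreover have "v\<^sup>2 / v ^ 4 = \<bar>- (1 / v\<^sup>2)\<bar>"
          using v by (simp add: power2_eq_square power4_eq_xxxx)
        ultimately show ?thesis by simp
      qed
      ultimately show ?thesis by blast
    qed
  qed
qed

section \<open>A discrete majorant\<close>

lemma exp_euler_minus_harm_bounds:
  assumes "r \<ge> 1"
  shows "1 / real (r + 1) \<le> exp (- harm r + euler_mascheroni)"
    and "exp (- harm r + euler_mascheroni) \<le> 1 / real r"
proof -
  have e: "euler_mascheroni \<in> {harm r - ln (real (Suc r)) + inverse (real (2 * (r + 1)))..
      harm r - ln (real (Suc r)) + inverse (real (2 * r))}"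
    using euler_mascheroni_bounds[OF assms] by simp
  have "exp (- ln (real (Suc r))) \<le> exp (- harm r + (euler_mascheroni::real))"
    using e by (simp del: of_nat_Suc) (smt (verit) inverse_nonnegative_iff_nonnegative of_nat_0_le_iff)
  thus "1 / real (r + 1) \<le> exp (- harm r + euler_mascheroni)"
    by (simp add: exp_minus inverse_eq_divide)
  have "exp (- harm r + (euler_mascheroni::real)) \<le> exp (- ln (real (Suc r)) + 1 / (2 * real r))"
    using e by (simp add: inverse_eq_divide)
  also have "\<dots> = exp (1 / (2 * real r)) / real (Suc r)"
    using exp_diff[of "1 / (2 * real r)" "ln (real (Suc r))"] by simp
  \<comment> \<open>The bound \<open>exp (1 / (2 * r)) \<le> 1 + 1 / r\<close> turns the denominator
    \<open>r + 1\<close> into \<open>r\<close>.\<close>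
  also have "\<dots> \<le> (1 + 2 * (1 / (2 * real r))) / real (Suc r)"
    using exp_bound_half[of "1 / (2 * real r)"] exp_bound_lemma[of "1 / (2 * real r)"] assms
    by (intro divide_right_mono) (auto simp: field_simps)
  also have "1 + 2 * (1 / (2 * real r)) = real (Suc r) / real r" using assms by (simp add: field_simps)
  also have "real (Suc r) / real r / real (Suc r) = 1 / real r" by simp
  finally show "exp (- harm r + (euler_mascheroni::real)) \<le> 1 / real r" .
qed

text \<open>
  The factor \<open>2 - (r + 1)/m\<close> increases slowly, which leaves room for source terms in the recursion.
\<close>

definition majorant :: "nat \<Rightarrow> nat \<Rightarrow> real" where
  "majorant r m = dickman (real m / real (r + 1)) * (2 - real (r + 1) / real m)"

text \<open>Each value is at most the mean of \<open>dickman\<close> over the grid step to its left.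
  At scale \<open>r + 1\<close> the unit interval of \<open>dickman_integral_eq\<close> has
  \<open>r + 1\<close> steps, one more than there are terms; the last step, worth at least the value
  at \<open>m\<close>, accounts for the \<open>- 1\<close>.\<close>

lemma dickman_sum_le:
  assumes "r \<ge> 1" "m \<ge> 2 * r + 1"
  shows "(\<Sum>j=m-r..<m. dickman (real j / real (r + 1))) \<le> (real m - 1) * dickman (real m / real (r + 1))"
proof -
  define s where "s = real (r + 1)"
  have s: "s > 0" "s = real r + 1" by (auto simp: s_def)
  have step: "dickman (real (Suc j) / s) \<le> s * (dickman_prim (real (Suc j) / s) - dickman_prim (real j / s))" for j
  proof -
    have lt: "real j / s < real (Suc j) / s" using s by (intro divide_strict_right_mono) auto
    obtain \<xi> where \<xi>: "real j / s < \<xi>" "\<xi> < real (Suc j) / s"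
      "dickman_prim (real (Suc j) / s) - dickman_prim (real j / s)
        = (real (Suc j) / s - real j / s) * dickman \<xi>"
      using dickman_prim_diff[OF _ lt] s by auto
    have "real (Suc j) / s - real j / s = 1 / s"
      by (simp add: add_divide_distrib)
    hence "s * (dickman_prim (real (Suc j) / s) - dickman_prim (real j / s)) = dickman \<xi>"
      unfolding \<xi>(3) using s by simp
    moreover have "0 \<le> \<xi>" using \<xi>(1) s by (smt (verit) divide_nonneg_pos of_nat_0_le_iff)
    hence "dickman (real (Suc j) / s) \<le> dickman \<xi>" using \<xi> by (intro dickman_antimono) auto
    ultimately show ?thesis by simp
  qed
  define p where "p = m - r - 2"
  have p: "m = Suc (r + Suc p)" using assms by (simp add: p_def)
  have "(\<Sum>j=m-r..<m. dickman (real j / s)) = (\<Sum>j=Suc p..<Suc p + r. dickman (real (Suc j) / s))"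
    unfolding p by (rule sum.reindex_bij_witness[where i = Suc and j = "\<lambda>j. j - 1"]) auto
  also have "\<dots> \<le> (\<Sum>j=Suc p..<Suc p + r. s * (dickman_prim (real (Suc j) / s) - dickman_prim (real j / s)))"
    by (intro sum_mono step)
  also have "\<dots> = s * (dickman_prim (real (Suc p + r) / s) - dickman_prim (real (Suc p) / s))"
    unfolding sum_distrib_left[symmetric] by (subst sum_Suc_diff') auto
  also have "\<dots> = s * (dickman_prim (real m / s) - dickman_prim (real m / s - 1))
      - s * (dickman_prim (real (Suc (r + Suc p)) / s) - dickman_prim (real (r + Suc p) / s))"
  proof -
    have "real m / s - 1 = real (Suc p) / s" using s by (simp add: p field_simps)
    thus ?thesis by (simp add: p algebra_simps)
  qed
  also have "s * (dickman_prim (real m / s) - dickman_prim (real m / s - 1)) = real m * dickman (real m / s)"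
  proof -
    have "real m / s \<ge> 1" using assms s by (simp add: field_simps)
    from dickman_integral_eq[OF this, symmetric] show ?thesis using s by simp
  qed
  also have "real m * dickman (real m / s)
      - s * (dickman_prim (real (Suc (r + Suc p)) / s) - dickman_prim (real (r + Suc p) / s))
      \<le> real m * dickman (real m / s) - dickman (real m / s)"
    using step[of "r + Suc p"] p by simp
  finally show ?thesis by (simp add: s_def algebra_simps)
qed

text \<open>With \<open>s = r + 1\<close>, the tilt at \<open>j\<close> falls short of the tilt at
  \<open>m\<close> by at least \<open>s * (m - j) / m ^ 2\<close>. Summing these shortfalls against
  \<open>dickman v\<close> gives the subtracted term, which later absorbs the sources.\<close>

lemma majorant_sum_le:
  assumes "r \<ge> 1" "m \<ge> 2 * r + 1"
  defines "v \<equiv> real m / real (r + 1)"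
  shows "(\<Sum>j=m-r..<m. majorant r j) \<le> (real m - 1) * majorant r m - real r * dickman v / (2 * v\<^sup>2)"
proof -
  define s where "s = real (r + 1)"
  have s: "s > 0" "s = real r + 1" by (auto simp: s_def)
  have v: "v = real m / s" by (simp add: v_def s_def)
  have m: "real m > 0" using assms(2) by simp
  have sm: "s \<le> real m" using assms(2) by (simp add: s_def)
  have "(\<Sum>j=m-r..<m. majorant r j)
    \<le> (\<Sum>j=m-r..<m. (2 - s / m) * dickman (real j / s) - s / (real m)\<^sup>2 * dickman v * real (m - j))"
  proof (rule sum_mono)
    fix j assume j: "j \<in> {m - r..<m}"
    hence j0: "real j > 0" "real j \<le> real m" "real (m - j) = real m - real j" using assms by auto
    have d0: "dickman v \<le> dickman (real j / s)" "dickman v > 0"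
      unfolding v using j0 s m by (auto intro!: dickman_antimono dickman_pos divide_right_mono)
    have "s / (real m)\<^sup>2 * real (m - j) \<le> s / j - s / m"
    proof -
      have "s / j - s / m = s * (real m - real j) / (real j * real m)"
        using j0 m by (simp add: field_simps)
      moreover have "s * (real m - real j) / (real m * real m) \<le> s * (real m - real j) / (real j * real m)"
        using j0 m s by (intro divide_left_mono mult_right_mono mult_nonneg_nonneg mult_pos_pos) auto
      ultimately show ?thesis by (simp add: j0(3) power2_eq_square)
    qed
    hence "dickman v * (s / (real m)\<^sup>2 * real (m - j)) \<le> dickman (real j / s) * (s / j - s / m)"
      using d0 s by (intro mult_mono) auto
    hence "dickman (real j / s) * (2 - s / j) \<le> (2 - s / m) * dickman (real j / s) - s / (real m)\<^sup>2 * dickman v * real (m - j)"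
      by (simp add: algebra_simps)
    thus "majorant r j \<le> (2 - s / m) * dickman (real j / s) - s / (real m)\<^sup>2 * dickman v * real (m - j)"
      by (simp add: majorant_def s_def)
  qed
  also have "\<dots> = (2 - s / m) * (\<Sum>j=m-r..<m. dickman (real j / s))
      - s / (real m)\<^sup>2 * dickman v * real (\<Sum>j=m-r..<m. m - j)"
    by (simp only: sum_subtractf sum_distrib_left of_nat_sum)
  also have "real (\<Sum>j=m-r..<m. m - j) = real r * s / 2"
  proof -
    have "(\<Sum>j=m-r..<m. m - j) = (\<Sum>i=1..r. i)"
      by (rule sum.reindex_bij_witness[where i = "\<lambda>i. m - i" and j = "\<lambda>i. m - i"]) (use assms in auto)
    also have "real (\<Sum>i=1..r. i) = real r * s / 2"
      using double_gauss_sum_from_Suc_0[of r, where 'a = real] by (simp add: s_def mult.commute add.commute)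
    finally show ?thesis .
  qed
  also have "(2 - s / m) * (\<Sum>j=m-r..<m. dickman (real j / s)) \<le> (2 - s / m) * ((real m - 1) * dickman v)"
    using dickman_sum_le[OF assms(1,2)] sm m by (intro mult_left_mono) (auto simp: v s_def field_simps)
  also have "(2 - s / m) * ((real m - 1) * dickman v) = (real m - 1) * majorant r m"
    by (simp add: majorant_def v s_def)
  also have "s / (real m)\<^sup>2 * dickman v * (real r * s / 2) = real r * dickman v / (2 * v\<^sup>2)"
    using m s by (simp add: v field_simps power2_eq_square)
  finally show ?thesis by simp
qed

text \<open>Passing to the next block of \<open>s\<close> indices shifts the argument by 1, so
  \<open>dickman_add_nat_le\<close> yields a geometric series; the upper limit is first raised to
  complete \<open>N\<close> blocks.\<close>

lemma dickman_tail_sum_le: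
  assumes "s \<ge> 1" "n \<ge> s"
  shows "(\<Sum>m=n..<N. dickman (real m / real s)) \<le> 2 * real s * dickman (real n / real s)"
proof -
  have s: "real s > 0" using assms by simp
  have ge1: "real n / real s \<ge> 1" using assms by simp
  have nn: "dickman (real m / real s) \<ge> 0" for m
    using dickman_pos[of "real m / real s"] s by (simp add: less_imp_le)
  have "(\<Sum>m=n..<N. dickman (real m / real s)) \<le> (\<Sum>m=n..<n + N * s. dickman (real m / real s))"
  proof (rule sum_mono2)
    have "N \<le> N * s" using assms by simp
    hence "N \<le> n + N * s" by (rule trans_le_add2)
    thus "{n..<N} \<subseteq> {n..<n + N * s}" by simp
  qed (use nn in auto)
  also have "\<dots> = (\<Sum>m<N * s. dickman (real (n + m) / real s))"
    by (rule sum.reindex_bij_witness[where i = "\<lambda>m. n + m" and j = "\<lambda>m. m - n"]) auto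
  also have "\<dots> = (\<Sum>i<N. \<Sum>m\<in>{i * s..<i * s + s}. dickman (real (n + m) / real s))"
    by (rule sum.nat_group[symmetric])
  also have "\<dots> \<le> (\<Sum>i<N. real s * dickman (real n / real s) * (1/2) ^ i)"
  proof (rule sum_mono)
    fix i
    have "(\<Sum>m\<in>{i * s..<i * s + s}. dickman (real (n + m) / real s))
        \<le> (\<Sum>m\<in>{i * s..<i * s + s}. dickman (real n / real s) / 2 ^ i)"
    proof (rule sum_mono)
      fix m assume m: "m \<in> {i * s..<i * s + s}"
      have "real (i * s) \<le> real m" using m by (simp only: of_nat_le_iff atLeastLessThan_iff)
      hence "(real n + real i * real s) / real s \<le> real (n + m) / real s"
        using s by (intro divide_right_mono) auto
      hence "real n / real s + real i \<le> real (n + m) / real s"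
        using s by (simp add: add_divide_distrib)
      hence "dickman (real (n + m) / real s) \<le> dickman (real n / real s + real i)"
        using ge1 by (intro dickman_antimono) auto
      also have "\<dots> \<le> dickman (real n / real s) / 2 ^ i" by (rule dickman_add_nat_le[OF ge1])
      finally show "dickman (real (n + m) / real s) \<le> dickman (real n / real s) / 2 ^ i" .
    qed
    thus "(\<Sum>m\<in>{i * s..<i * s + s}. dickman (real (n + m) / real s))
        \<le> real s * dickman (real n / real s) * (1/2) ^ i"
      by (simp add: power_one_over)
  qed
  also have "\<dots> = real s * dickman (real n / real s) * (\<Sum>i<N. (1/2) ^ i)"
    by (rule sum_distrib_left[symmetric])
  also have "(\<Sum>i<N. (1/2::real) ^ i) = 2 * (1 - (1/2) ^ N)"
    by (simp add: geometric_sum)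
  also have "real s * dickman (real n / real s) * (2 * (1 - (1/2) ^ N)) \<le> real s * dickman (real n / real s) * 2"
    using nn[of n] s by (intro mult_left_mono) auto
  finally show ?thesis by (simp add: mult_ac)
qed

section \<open>The error term\<close>

definition kappa_err :: "nat \<Rightarrow> nat \<Rightarrow> real" where
  "kappa_err r n = kappa n r - exp (- harm r + euler_mascheroni) * buchstab (real n / real r)"

lemma kappa_err_initial:
  assumes "r < n" "n \<le> 2 * r"
  shows "kappa_err r n = (1 - exp (- harm r + euler_mascheroni) * real r) / real n"
proof -
  have "buchstab (real n / real r) = real r / real n"
    using assms by (subst buchstab_eq_inverse) (auto simp: field_simps)
  thus ?thesis using assms by (simp add: kappa_err_def kappa_eq_inverse diff_divide_distrib)
qed

lemma exp_euler_minus_harm_err: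
  assumes "r \<ge> 1"
  shows "0 \<le> 1 - exp (- harm r + euler_mascheroni) * real r"
    and "1 - exp (- harm r + euler_mascheroni) * real r \<le> 1 / real r"
proof -
  note c = exp_euler_minus_harm_bounds[OF assms]
  have r: "real r > 0" using assms by simp
  have "exp (- harm r + euler_mascheroni) * real r \<le> 1 / real r * real r"
    using c r by (intro mult_right_mono) auto
  thus "0 \<le> 1 - exp (- harm r + euler_mascheroni) * real r" using r by simp
  have "1 / real (r + 1) * real r \<le> exp (- harm r + euler_mascheroni) * real r"
    using c r by (intro mult_right_mono) auto
  moreover have "1 - 1 / real (r + 1) * real r = 1 / real (r + 1)" using r by (simp add: field_simps)
  moreover have "1 / real (r + 1) \<le> 1 / real r" using r by (intro divide_left_mono) auto
  ultimately show "1 - exp (- harm r + euler_mascheroni) * real r \<le> 1 / real r" by linarith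
qed

lemma kappa_err_initial_bound:
  assumes "r \<ge> 1" "r < n" "n \<le> 2 * r"
  shows "\<bar>kappa_err r n\<bar> \<le> 1 / (real r)\<^sup>2"
proof -
  have "\<bar>kappa_err r n\<bar> = (1 - exp (- harm r + euler_mascheroni) * real r) / real n"
    using kappa_err_initial[OF assms(2,3)] exp_euler_minus_harm_err(1)[OF assms(1)] by simp
  also have "\<dots> \<le> (1 / real r) / real r"
    using exp_euler_minus_harm_err[OF assms(1)] assms by (intro frac_le) auto
  finally show ?thesis by (simp add: power2_eq_square)
qed

text \<open>The numerator in \<open>kappa_err_initial\<close> is at most \<open>1 / r\<close> and
  independent of \<open>n\<close>, while consecutive reciprocals differ by at most
  \<open>1 / r ^ 2\<close>. The bound \<open>n < 2 * r\<close> keeps \<open>n + 1\<close> in the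
  range of that formula.\<close>

lemma kappa_err_initial_diff:
  assumes "r \<ge> 1" "r < n" "n < 2 * r"
  shows "\<bar>kappa_err r (n + 1) - kappa_err r n\<bar> \<le> 1 / (real r) ^ 3"
proof -
  let ?e = "1 - exp (- harm r + euler_mascheroni) * real r"
  have n: "real n > 0" using assms by simp
  have "kappa_err r (n + 1) - kappa_err r n = - (?e * (1 / (real n * (real n + 1))))"
  proof -
    have "e / (x + 1) - e / x = - (e * (1 / (x * (x + 1))))" if "x > 0" for e x :: real
      using that by (simp add: field_simps)
    from this[OF n, of ?e] show ?thesis
      using kappa_err_initial[of r n] kappa_err_initial[of r "n + 1"] assms by (simp add: add.commute)
  qed
  hence "\<bar>kappa_err r (n + 1) - kappa_err r n\<bar> = ?e * (1 / (real n * (real n + 1)))"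
    using exp_euler_minus_harm_err(1)[OF assms(1)] n by (simp add: abs_mult)
  also have "\<dots> \<le> 1 / real r * (1 / (real r * real r))"
    using exp_euler_minus_harm_err[OF assms(1)] assms
    by (intro mult_mono divide_left_mono mult_pos_pos) auto
  finally show ?thesis by (simp add: power3_eq_cube)
qed

section \<open>Comparison of the recursions of \<open>kappa\<close> and
  \<open>buchstab\<close>\<close>

text \<open>By the mean value theorem: the kink at 2 is the grid point \<open>2 * r / r\<close>, so
  it never lies strictly between, and the derivative bound is largest at the left end.\<close>

lemma buchstab_grid_diff:
  assumes B: "\<And>v. v > 1 \<Longrightarrow> v \<noteq> 2 \<Longrightarrow>
      \<exists>d. (buchstab has_real_derivative d) (at v) \<and> \<bar>d\<bar> \<le> B * dickman v / v ^ 4" "B \<ge> 0"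
    and r: "r \<ge> 1" and k: "k \<ge> r" and t: "real k \<le> t" "t \<le> real k + 1"
  shows "\<bar>buchstab (t / r) - buchstab (real k / r)\<bar> \<le> B * dickman (real k / r) / (real k / r) ^ 4 / r"
proof (cases "t = real k")
  case True
  have "dickman (real k / real r) > 0" by (intro dickman_pos) auto
  thus ?thesis using True B(2) by simp
next
  case False
  have r0: "real r > 0" using r by simp
  have lt: "real k / r < t / r" using False t r0 by (intro divide_strict_right_mono) auto
  have k1: "real k / r \<ge> 1" using k r0 by simp
  have in_open: "v > 1 \<and> v \<noteq> 2" if "real k / r < v" "v < t / r" for v
  proof -
    have "v \<noteq> 2"
    proof
      assume v2: "v = 2"
      have "real k < real (2 * r)" using that(1) r0 unfolding v2 by (simp add: field_simps)
      moreover have "real (2 * r) < t" using that(2) r0 unfolding v2 by (simp add: field_simps)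
      hence "real (2 * r) < real (k + 1)" using t by simp
      ultimately show False unfolding of_nat_less_iff by linarith
    qed
    thus ?thesis using that k1 by auto
  qed
  have "\<exists>l z. real k / r < z \<and> z < t / r \<and> DERIV buchstab z :> l \<and>
      buchstab (t / r) - buchstab (real k / r) = (t / r - real k / r) * l"
  proof (rule MVT[OF lt])
    show "continuous_on {real k / r..t / r} buchstab"
      by (rule continuous_on_buchstab) (use k1 in auto)
    show "buchstab differentiable (at v)" if "real k / r < v" "v < t / r" for v
      using B(1)[of v] in_open[OF that] real_differentiable_def by blast
  qed
  then obtain l z where z: "real k / r < z" "z < t / r" "DERIV buchstab z :> l"
    "buchstab (t / r) - buchstab (real k / r) = (t / r - real k / r) * l" by blast
  have "\<bar>l\<bar> \<le> B * dickman z / z ^ 4"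
    using B(1)[of z] in_open[OF z(1,2)] DERIV_unique[OF z(3)] by blast
  also have "\<dots> \<le> B * dickman (real k / r) / (real k / r) ^ 4"
    using z(1) k1 k r r0 B(2) dickman_pos[of "real k / r"]
    by (intro frac_le mult_left_mono dickman_antimono power_mono mult_nonneg_nonneg) auto
  finally have l: "\<bar>l\<bar> \<le> B * dickman (real k / r) / (real k / r) ^ 4" .
  have w: "t / r - real k / r \<le> 1 / r" "0 \<le> t / r - real k / r"
    using t r0 lt by (auto simp: divide_right_mono simp flip: diff_divide_distrib)
  have "\<bar>buchstab (t / r) - buchstab (real k / r)\<bar> = (t / r - real k / r) * \<bar>l\<bar>"
    using w unfolding z(4) by (simp add: abs_mult)
  also have "\<dots> \<le> 1 / r * (B * dickman (real k / r) / (real k / r) ^ 4)"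
    using l w r0 by (intro mult_mono) auto
  finally show ?thesis by (simp add: mult.commute)
qed

text \<open>The mean value theorem for \<open>v * buchstab v\<close> over one grid step;
  \<open>t\<close> is \<open>r\<close> times the intermediate point lowered by 1.\<close>

lemma buchstab_grid_rec:
  assumes r: "r \<ge> 1" and m: "m \<ge> 2 * r"
  obtains t where "real (m - r) \<le> t" "t \<le> real (m - r) + 1"
    "real (m + 1) * buchstab (real (m + 1) / r) = real m * buchstab (real m / r) + buchstab (t / r)"
proof -
  have r0: "real r > 0" using r by simp
  define F where "F v = v * buchstab v" for v
  have lt: "real m / r < real (m + 1) / r" using r0 by (intro divide_strict_right_mono) auto
  have "2 * real r \<le> real m" using m by (metis of_nat_le_iff of_nat_mult of_nat_numeral)
  hence m2: "real m / r \<ge> 2" using r0 by (simp add: field_simps)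
  have der: "(F has_real_derivative buchstab (v - 1)) (at v)" if "real m / r < v" for v
    unfolding F_def by (rule has_real_derivative_mult_buchstab) (use that m2 in simp)
  have "\<exists>l z. real m / r < z \<and> z < real (m + 1) / r \<and> DERIV F z :> l \<and>
      F (real (m + 1) / r) - F (real m / r) = (real (m + 1) / r - real m / r) * l"
  proof (rule MVT[OF lt])
    show "continuous_on {real m / r..real (m + 1) / r} F"
      unfolding F_def by (intro continuous_intros continuous_on_buchstab) (use m2 in auto)
    show "F differentiable (at v)" if "real m / r < v" for v
      using der[OF that] real_differentiable_def by blast
  qed
  then obtain l z where z: "real m / r < z" "z < real (m + 1) / r" "DERIV F z :> l"
    "F (real (m + 1) / r) - F (real m / r) = (real (m + 1) / r - real m / r) * l" by blast
  have l: "l = buchstab (z - 1)" using DERIV_unique[OF z(3) der[OF z(1)]] .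
  show ?thesis
  proof (rule that[of "r * (z - 1)"])
    have "real m < r * z" "r * z < real m + 1" using z r0 by (auto simp: field_simps)
    moreover have "real (m - r) = real m - r" using m by simp
    ultimately show "real (m - r) \<le> r * (z - 1)" "r * (z - 1) \<le> real (m - r) + 1"
      by (simp_all add: algebra_simps)
    have "r * (F (real (m + 1) / r) - F (real m / r)) = buchstab (z - 1)"
      unfolding z(4) l using r0 by (simp add: field_simps)
    thus "real (m + 1) * buchstab (real (m + 1) / r) = real m * buchstab (real m / r) + buchstab (r * (z - 1) / r)"
    proof -
      have e: "real r * (z - 1) / real r = z - 1" using r0 by simp
      have c: "real r * (x / real r * y) = x * y" for x y using r0 by simp
      have "real (m + 1) * buchstab (real (m + 1) / r) - real m * buchstab (real m / r) = buchstab (z - 1)"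
        using \<open>r * (F (real (m + 1) / r) - F (real m / r)) = buchstab (z - 1)\<close>
        unfolding F_def right_diff_distrib c .
      thus ?thesis unfolding e by linarith
    qed
  qed
qed

text \<open>
  At \<open>m = 2r\<close> the difference is only \<open>O(1/r\<^sup>2)\<close>: there \<open>kappa\<close> still equals \<open>1/n\<close> while \<open>buchstab\<close> has
  passed its kink at \<open>2\<close>.
\<close>

lemma kappa_err_diff_bump:
  assumes B: "\<And>v. v > 1 \<Longrightarrow> v \<noteq> 2 \<Longrightarrow>
      \<exists>d. (buchstab has_real_derivative d) (at v) \<and> \<bar>d\<bar> \<le> B * dickman v / v ^ 4" "B \<ge> 0"
    and r: "r \<ge> 1"
  shows "\<bar>kappa_err r (2 * r + 1) - kappa_err r (2 * r)\<bar> \<le> (1 + B) / (real r)\<^sup>2"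
proof -
  let ?c = "exp (- harm r + euler_mascheroni)"
  have r0: "real r > 0" using r by simp
  have "\<bar>buchstab (real (2 * r + 1) / r) - buchstab (real (2 * r) / r)\<bar>
      \<le> B * dickman (real (2 * r) / r) / (real (2 * r) / r) ^ 4 / r"
    by (rule buchstab_grid_diff[OF B r]) auto
  also have "\<dots> \<le> B * 1 / 1 / r"
    using r0 B(2) dickman_le_1[of 2] by (intro divide_right_mono frac_le mult_left_mono) auto
  finally have b: "\<bar>buchstab (real (2 * r + 1) / r) - buchstab (real (2 * r) / r)\<bar> \<le> B / r" by simp
  have "?c * \<bar>buchstab (real (2 * r + 1) / r) - buchstab (real (2 * r) / r)\<bar> \<le> 1 / r * (B / r)"
    using exp_euler_minus_harm_bounds(2)[OF r] b by (intro mult_mono) auto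
  hence cb: "\<bar>?c * (buchstab (real (2 * r + 1) / r) - buchstab (real (2 * r) / r))\<bar> \<le> B / (real r)\<^sup>2"
    by (simp add: abs_mult power2_eq_square)
  have "kappa (2 * r + 1) r - kappa (2 * r) r = - (1 / (real (2 * r) * real (2 * r + 1)))"
  proof -
    have "1 / (x + 1) - 1 / x = - (1 / (x * (x + 1)))" if "x > 0" for x :: real
      using that by (simp add: field_simps)
    from this[of "real (2 * r)"] show ?thesis
      using kappa_eq_inverse[of r "2 * r"] kappa_eq_inverse[of r "2 * r + 1"] r0 by (simp add: add.commute)
  qed
  moreover have "1 / (real (2 * r) * real (2 * r + 1)) \<le> 1 / (real r * real r)"
    using r0 by (intro divide_left_mono mult_mono) auto
  ultimately have "\<bar>kappa (2 * r + 1) r - kappa (2 * r) r\<bar> \<le> 1 / (real r)\<^sup>2"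
    by (simp add: power2_eq_square)
  moreover have "kappa_err r (2 * r + 1) - kappa_err r (2 * r) = (kappa (2 * r + 1) r - kappa (2 * r) r)
      - ?c * (buchstab (real (2 * r + 1) / r) - buchstab (real (2 * r) / r))"
    by (simp add: kappa_err_def algebra_simps)
  ultimately show ?thesis using cb by (simp add: add_divide_distrib)
qed

text \<open>Subtracting \<open>buchstab_grid_rec\<close> from \<open>kappa_rec\<close> leaves
  \<open>kappa_err r (m - r) - kappa_err r m\<close>, which telescopes, and the discrepancy of
  \<open>buchstab\<close> between \<open>t / r\<close> and the grid point
  \<open>(m - r) / r\<close>.\<close>

lemma kappa_err_diff_rec:
  assumes B: "\<And>v. v > 1 \<Longrightarrow> v \<noteq> 2 \<Longrightarrow>
      \<exists>d. (buchstab has_real_derivative d) (at v) \<and> \<bar>d\<bar> \<le> B * dickman v / v ^ 4" "B \<ge> 0"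
    and r: "r \<ge> 1" and m: "m \<ge> 2 * r + 1"
  defines "v \<equiv> real m / real (r + 1)"
  shows "real (m + 1) * \<bar>kappa_err r (m + 1) - kappa_err r m\<bar>
    \<le> (\<Sum>j=m-r..<m. \<bar>kappa_err r (j + 1) - kappa_err r j\<bar>) + 64 * B * (dickman v / ((real r)\<^sup>2 * v\<^sup>2))"
proof -
  let ?c = "exp (- harm r + euler_mascheroni)"
  let ?x = "real (m - r) / real r"
  have r0: "real r > 0" using r by simp
  have mr: "real (m - r) = real m - real r" using m by simp
  have mr1: "real m \<ge> 2 * real r + 1" using m by linarith
  obtain t where t: "real (m - r) \<le> t" "t \<le> real (m - r) + 1"
    "real (m + 1) * buchstab (real (m + 1) / r) = real m * buchstab (real m / r) + buchstab (t / r)"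
    using buchstab_grid_rec[OF r, of m] m by auto
  have "real (m + 1) * (kappa_err r (m + 1) - kappa_err r m)
      = (real (m + 1) * kappa (m + 1) r - real (m + 1) * kappa m r)
        - ?c * (real (m + 1) * buchstab (real (m + 1) / r) - real (m + 1) * buchstab (real m / r))"
    by (simp add: kappa_err_def algebra_simps)
  also have "\<dots> = kappa_err r (m - r) - kappa_err r m - ?c * (buchstab (t / r) - buchstab ?x)"
    unfolding t(3) using kappa_rec[of m r] m by (simp add: kappa_err_def algebra_simps)
  also have "kappa_err r (m - r) - kappa_err r m = - (\<Sum>j=m-r..<m. kappa_err r (j + 1) - kappa_err r j)"
    using sum_Suc_diff'[of "m - r" m "kappa_err r"] by simp
  finally have eq: "real (m + 1) * (kappa_err r (m + 1) - kappa_err r m)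
    = - (\<Sum>j=m-r..<m. kappa_err r (j + 1) - kappa_err r j) - ?c * (buchstab (t / r) - buchstab ?x)" .
  have "\<bar>?c * (buchstab (t / r) - buchstab ?x)\<bar> \<le> 64 * B * (dickman v / ((real r)\<^sup>2 * v\<^sup>2))"
  proof -
    have v: "v \<ge> 3/2" using mr1 r unfolding v_def by (simp add: field_simps)
    have xv: "v - 1 \<le> ?x"
    proof -
      have "v - 1 = (real m - real r - 1) / (real r + 1)" by (simp add: v_def field_simps)
      also have "\<dots> \<le> (real m - real r) / real r" using mr1 r0 by (intro frac_le) auto
      finally show ?thesis by (simp add: mr)
    qed
    have vx: "v / 2 \<le> ?x"
    proof -
      have "v / 2 = (real m / 2) / (real r + 1)" by (simp add: v_def)
      also have "\<dots> \<le> (real m - real r) / real r" using mr1 r0 by (intro frac_le) auto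
      finally show ?thesis by (simp add: mr)
    qed
    have "\<bar>buchstab (t / r) - buchstab ?x\<bar> \<le> B * dickman ?x / ?x ^ 4 / r"
      by (rule buchstab_grid_diff[OF B r]) (use t m in auto)
    \<comment> \<open>The constant 64 is 4 from \<open>dickman_shift_le\<close> times
      \<open>2 ^ 4\<close> from replacing \<open>?x\<close> by \<open>v / 2\<close>.\<close>
    also have "\<dots> \<le> B * (4 * v\<^sup>2 * dickman v) / (v / 2) ^ 4 / r"
    proof (rule divide_right_mono, rule frac_le)
      have "dickman ?x \<le> 4 * v\<^sup>2 * dickman v"
        using dickman_antimono[OF _ xv] dickman_shift_le[OF v] v by simp
      thus "B * dickman ?x \<le> B * (4 * v\<^sup>2 * dickman v)" using B(2) by (rule mult_left_mono)
      show "0 \<le> B * (4 * v\<^sup>2 * dickman v)" using B(2) dickman_pos[of v] v by simp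
      show "(v / 2) ^ 4 \<le> ?x ^ 4" by (rule power_mono[OF vx]) (use v in simp)
    qed (use v r0 in auto)
    also have "\<dots> = 64 * B * (dickman v / v\<^sup>2) / r"
      using v by (simp add: power_divide power2_eq_square power4_eq_xxxx)
    finally have "?c * \<bar>buchstab (t / r) - buchstab ?x\<bar> \<le> 1 / r * (64 * B * (dickman v / v\<^sup>2) / r)"
      using exp_euler_minus_harm_bounds(2)[OF r] by (intro mult_mono) auto
    thus ?thesis by (simp add: abs_mult power2_eq_square mult_ac)
  qed
  moreover have "\<bar>\<Sum>j=m-r..<m. kappa_err r (j + 1) - kappa_err r j\<bar>
      \<le> (\<Sum>j=m-r..<m. \<bar>kappa_err r (j + 1) - kappa_err r j\<bar>)" by (rule sum_abs)
  moreover have "real (m + 1) * \<bar>kappa_err r (m + 1) - kappa_err r m\<bar>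
      = \<bar>real (m + 1) * (kappa_err r (m + 1) - kappa_err r m)\<bar>" by (simp add: abs_mult)
  ultimately show ?thesis unfolding eq by linarith
qed

section \<open>Induction against the majorant, and summation\<close>

lemma majorant_ge:
  assumes "j \<ge> r + 1"
  shows "dickman (real j / real (r + 1)) \<le> majorant r j"
proof -
  have "dickman (real j / real (r + 1)) * 1 \<le> dickman (real j / real (r + 1)) * (2 - real (r + 1) / real j)"
    using assms dickman_pos[of "real j / real (r + 1)"] by (intro mult_left_mono) auto
  thus ?thesis by (simp add: majorant_def)
qed

lemma majorant_le: "majorant r j \<le> 2 * dickman (real j / real (r + 1))"
proof -
  have "dickman (real j / real (r + 1)) * (2 - real (r + 1) / real j) \<le> dickman (real j / real (r + 1)) * 2"
    using dickman_pos[of "real j / real (r + 1)"] by (intro mult_left_mono) auto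
  thus ?thesis by (simp add: majorant_def)
qed

text \<open>Half of the saving in \<open>majorant_sum_le\<close> pays for the source in
  \<open>kappa_err_diff_rec\<close>, the other half for the large difference at
  \<open>2 * r\<close>, which lies in the window only for \<open>m \<le> 3 * r\<close>. The
  conditions on \<open>A\<close> serve, in this order, the range below \<open>2 * r\<close>, this
  exceptional difference and the source.\<close>

lemma kappa_err_diff_bound:
  assumes B: "\<And>v. v > 1 \<Longrightarrow> v \<noteq> 2 \<Longrightarrow>
      \<exists>d. (buchstab has_real_derivative d) (at v) \<and> \<bar>d\<bar> \<le> B * dickman v / v ^ 4" "B \<ge> 0"
    and A: "A \<ge> 1 / dickman 2" "A \<ge> 36 * (1 + B) / dickman 3" "A \<ge> 256 * B"
    and r: "r \<ge> 1" and m: "m \<ge> r + 1" "m \<noteq> 2 * r"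
  shows "\<bar>kappa_err r (m + 1) - kappa_err r m\<bar> \<le> A / (real r) ^ 3 * majorant r m"
  using m
proof (induction m rule: less_induct)
  case (less m)
  let ?D = "\<lambda>m. \<bar>kappa_err r (m + 1) - kappa_err r m\<bar>"
  have r0: "real r > 0" using r by simp
  have d2: "dickman 2 > 0" "dickman 3 > 0" by (auto intro: dickman_pos)
  have A0: "A \<ge> 0" using A(3) B(2) by simp
  have maj0: "majorant r j \<ge> 0" if "j \<ge> r + 1" for j
    using majorant_ge[OF that] dickman_pos[of "real j / real (r + 1)"] by simp
  show ?case
  proof (cases "m < 2 * r")
    case True
    have "dickman 2 \<le> majorant r m"
    proof -
      have "dickman 2 \<le> dickman (real m / real (r + 1))"
        using True by (intro dickman_antimono) (auto simp: field_simps)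
      thus ?thesis using majorant_ge[of r m] less.prems by simp
    qed
    moreover have "1 \<le> A * dickman 2" using A(1) d2 by (simp add: field_simps)
    ultimately have "1 \<le> A * majorant r m" using A0 by (smt (verit) mult_left_mono)
    hence "1 / real r ^ 3 \<le> A * majorant r m / real r ^ 3" using r0 by (intro divide_right_mono) auto
    thus ?thesis using kappa_err_initial_diff[OF r, of m] True less.prems by simp
  next
    case False
    hence m: "m \<ge> 2 * r + 1" using less.prems by simp
    define v where "v = real m / real (r + 1)"
    define e where "e = dickman v / ((real r)\<^sup>2 * v\<^sup>2)"
    have v0: "v > 0" using m by (simp add: v_def)
    have e0: "e \<ge> 0" unfolding e_def using dickman_pos[of v] v0 by simp
    define bump where "bump = (if m \<le> 3 * r then (1 + B) / (real r)\<^sup>2 else 0)"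
    \<comment> \<open>The 36 in the condition on \<open>A\<close> is \<open>4 * 9\<close>: for
      \<open>v \<le> 3\<close>, \<open>dickman v / v ^ 2\<close> is at least
      \<open>dickman 3 / 9\<close>.\<close>
    have bump: "bump \<le> A / 4 * e"
    proof (cases "m \<le> 3 * r")
      case True
      have v3: "v \<le> 3" using True by (simp add: v_def field_simps)
      have "dickman 3 / 9 \<le> dickman v / v\<^sup>2"
        using v0 v3 power_mono[of v 3 2] dickman_pos[of v] by (intro frac_le dickman_antimono) auto
      hence "36 * (1 + B) / dickman 3 / 4 * (dickman 3 / 9) \<le> A / 4 * (dickman v / v\<^sup>2)"
        by (intro mult_mono divide_right_mono A(2)) (use A0 d2 in auto)
      hence "1 + B \<le> A / 4 * (dickman v / v\<^sup>2)" using d2 by simp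
      hence "(1 + B) / (real r)\<^sup>2 \<le> A / 4 * (dickman v / v\<^sup>2) / (real r)\<^sup>2"
        by (intro divide_right_mono) auto
      thus ?thesis using True by (simp add: bump_def e_def mult_ac)
    qed (use A0 e0 in \<open>simp add: bump_def\<close>)
    have b0: "bump \<ge> 0" using B(2) by (simp add: bump_def)
    have "(\<Sum>j=m-r..<m. ?D j) \<le> (\<Sum>j=m-r..<m. A / real r ^ 3 * majorant r j + (if j = 2 * r then bump else 0))"
    proof (rule sum_mono)
      fix j assume j: "j \<in> {m - r..<m}"
      hence j1: "j \<ge> r + 1" using m by auto
      show "?D j \<le> A / real r ^ 3 * majorant r j + (if j = 2 * r then bump else 0)"
      proof (cases "j = 2 * r")
        case True
        hence "m \<le> 3 * r" using j m by auto
        moreover have "A / real r ^ 3 * majorant r j \<ge> 0" using A0 maj0[OF j1] by simp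
        ultimately show ?thesis
          using kappa_err_diff_bump[OF B r] True by (simp add: bump_def)
      next
        case False
        thus ?thesis using less.IH[of j] j j1 by simp
      qed
    qed
    also have "\<dots> = A / real r ^ 3 * (\<Sum>j=m-r..<m. majorant r j) + (\<Sum>j=m-r..<m. if j = 2 * r then bump else 0)"
      by (simp only: sum.distrib sum_distrib_left)
    also have "(\<Sum>j=m-r..<m. if j = 2 * r then bump else 0) \<le> bump"
      using b0 by (simp add: sum.delta)
    also have "A / real r ^ 3 * (\<Sum>j=m-r..<m. majorant r j)
        \<le> A / real r ^ 3 * ((real m - 1) * majorant r m - real r * dickman v / (2 * v\<^sup>2))"
      using majorant_sum_le[OF r m] A0 r0 unfolding v_def by (intro mult_left_mono) auto
    also have "\<dots> = A / real r ^ 3 * ((real m - 1) * majorant r m) - A / 2 * e"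
      using r0 by (simp add: e_def right_diff_distrib power3_eq_cube power2_eq_square)
    finally have S: "(\<Sum>j=m-r..<m. ?D j) \<le> A / real r ^ 3 * ((real m - 1) * majorant r m) - A / 2 * e + bump"
      by simp
    have "real (m + 1) * ?D m \<le> (\<Sum>j=m-r..<m. ?D j) + 64 * B * e"
      using kappa_err_diff_rec[OF B r m] unfolding e_def v_def .
    moreover have "64 * B * e \<le> A / 4 * e" using A(3) e0 by (intro mult_right_mono) auto
    ultimately have "real (m + 1) * ?D m \<le> A / real r ^ 3 * ((real m - 1) * majorant r m)"
      using S bump by simp
    also have "\<dots> \<le> A / real r ^ 3 * (real (m + 1) * majorant r m)"
      using A0 r0 maj0[of m] less.prems by (intro mult_left_mono mult_right_mono) auto
    also have "\<dots> = real (m + 1) * (A / real r ^ 3 * majorant r m)" by (simp only: mult_ac)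
    finally show ?thesis by (rule mult_left_le_imp_le) simp
  qed
qed

text \<open>Starting at \<open>2 * r + 1\<close> avoids the exceptional index. Summing the
  differences costs a factor of order \<open>r\<close>, which turns \<open>r ^ 3\<close> into
  \<open>r ^ 2\<close>.\<close>

lemma kappa_err_bounds:
  obtains K where "K > 0" "\<And>r. r \<ge> 1 \<Longrightarrow> \<bar>kappa_err r (2 * r + 1)\<bar> \<le> K / (real r)\<^sup>2"
    "\<And>r n N. r \<ge> 1 \<Longrightarrow> 2 * r + 1 \<le> n \<Longrightarrow> n \<le> N \<Longrightarrow>
      \<bar>kappa_err r N - kappa_err r n\<bar> \<le> K / (real r)\<^sup>2 * dickman (real n / real (r + 1))"
proof -
  obtain B where B: "B > 0" "\<And>v. v > 1 \<Longrightarrow> v \<noteq> 2 \<Longrightarrow>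
      \<exists>d. (buchstab has_real_derivative d) (at v) \<and> \<bar>d\<bar> \<le> B * dickman v / v ^ 4"
    by (rule buchstab_deriv_bound) blast
  have B0: "B \<ge> 0" using B(1) by simp
  define A where "A = max (1 / dickman 2) (max (36 * (1 + B) / dickman 3) (256 * B))"
  have A: "A \<ge> 1 / dickman 2" "A \<ge> 36 * (1 + B) / dickman 3" "A \<ge> 256 * B"
    by (auto simp: A_def)
  have A0: "A > 0" using A(3) B(1) by simp
  \<comment> \<open>\<open>8 * A\<close> collects factors 2 from \<open>majorant_le\<close>, the
    tail sum and \<open>r + 1 \<le> 2 * r\<close>; \<open>2 + B\<close> is for the value at
    \<open>2 * r + 1\<close>.\<close>
  define K where "K = 8 * A + (2 + B)"
  have K0: "K > 0" using A0 B(1) by (simp add: K_def)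
  show ?thesis
  proof (rule that[OF K0])
    fix r :: nat assume r: "r \<ge> 1"
    have "\<bar>kappa_err r (2 * r + 1)\<bar> \<le> \<bar>kappa_err r (2 * r)\<bar> + \<bar>kappa_err r (2 * r + 1) - kappa_err r (2 * r)\<bar>"
      by linarith
    also have "\<dots> \<le> 1 / (real r)\<^sup>2 + (1 + B) / (real r)\<^sup>2"
      using r by (intro add_mono kappa_err_initial_bound kappa_err_diff_bump[OF B(2) B0]) auto
    also have "\<dots> = (2 + B) / (real r)\<^sup>2" by (simp add: add_divide_distrib)
    also have "\<dots> \<le> K / (real r)\<^sup>2" using A0 by (intro divide_right_mono) (auto simp: K_def)
    finally show "\<bar>kappa_err r (2 * r + 1)\<bar> \<le> K / (real r)\<^sup>2" .
  next
    fix r n N :: nat assume r: "r \<ge> 1" and n: "2 * r + 1 \<le> n" "n \<le> N"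
    have r0: "real r > 0" using r by simp
    have p: "dickman (real n / real (r + 1)) > 0" by (intro dickman_pos) auto
    have "\<bar>kappa_err r N - kappa_err r n\<bar> = \<bar>\<Sum>m=n..<N. kappa_err r (m + 1) - kappa_err r m\<bar>"
      using sum_Suc_diff'[OF n(2), of "kappa_err r"] by simp
    also have "\<dots> \<le> (\<Sum>m=n..<N. \<bar>kappa_err r (m + 1) - kappa_err r m\<bar>)" by (rule sum_abs)
    also have "\<dots> \<le> (\<Sum>m=n..<N. A / real r ^ 3 * (2 * dickman (real m / real (r + 1))))"
    proof (rule sum_mono)
      fix m assume "m \<in> {n..<N}"
      hence m: "m \<ge> r + 1" "m \<noteq> 2 * r" using n by auto
      have "A / real r ^ 3 * majorant r m \<le> A / real r ^ 3 * (2 * dickman (real m / real (r + 1)))"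
        using A0 by (intro mult_left_mono majorant_le) auto
      thus "\<bar>kappa_err r (m + 1) - kappa_err r m\<bar> \<le> A / real r ^ 3 * (2 * dickman (real m / real (r + 1)))"
        using kappa_err_diff_bound[OF B(2) B0 A r m] by simp
    qed
    also have "\<dots> = 2 * A / real r ^ 3 * (\<Sum>m=n..<N. dickman (real m / real (r + 1)))"
      by (simp add: sum_distrib_left mult_ac)
    also have "\<dots> \<le> 2 * A / real r ^ 3 * (2 * real (r + 1) * dickman (real n / real (r + 1)))"
      using A0 n r by (intro mult_left_mono dickman_tail_sum_le) auto
    also have "\<dots> \<le> 2 * A / real r ^ 3 * (2 * (2 * real r) * dickman (real n / real (r + 1)))"
      using A0 r p by (intro mult_left_mono mult_right_mono) auto
    also have "\<dots> = 8 * A / (real r)\<^sup>2 * dickman (real n / real (r + 1))"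
      using r0 by (simp add: power3_eq_cube power2_eq_square)
    also have "\<dots> \<le> K / (real r)\<^sup>2 * dickman (real n / real (r + 1))"
      using p B(1) by (intro mult_right_mono divide_right_mono) (auto simp: K_def)
    finally show "\<bar>kappa_err r N - kappa_err r n\<bar> \<le> K / (real r)\<^sup>2 * dickman (real n / real (r + 1))" .
  qed
qed

section \<open>The limit of the error term\<close>

text \<open>The limit of \<open>kappa_err r\<close> is \<open>?c r\<close> times a constant
  independent of \<open>r\<close>. As \<open>?c r\<close> is at least \<open>1 / (2 * r)\<close> and
  the limit is \<open>O(1 / r ^ 2)\<close>, that constant is 0.\<close>

lemma kappa_err_tendsto_0:
  assumes r: "r \<ge> 1"
  shows "kappa_err r \<longlonglongrightarrow> 0"
proof -
  obtain K where K: "K > 0" "\<And>r. r \<ge> 1 \<Longrightarrow> \<bar>kappa_err r (2 * r + 1)\<bar> \<le> K / (real r)\<^sup>2"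
    "\<And>r n N. r \<ge> 1 \<Longrightarrow> 2 * r + 1 \<le> n \<Longrightarrow> n \<le> N \<Longrightarrow>
      \<bar>kappa_err r N - kappa_err r n\<bar> \<le> K / (real r)\<^sup>2 * dickman (real n / real (r + 1))"
    by (rule kappa_err_bounds) blast
  have conv: "convergent (kappa_err r)" if r: "r \<ge> 1" for r
  proof -
    have "Cauchy (kappa_err r)"
    proof (rule CauchyI')
      fix e :: real assume e: "e > 0"
      obtain M where M: "real M > K / (real r)\<^sup>2 * real (r + 1) / e"
        using reals_Archimedean2 by blast
      show "\<exists>M. \<forall>m\<ge>M. \<forall>n>m. dist (kappa_err r m) (kappa_err r n) < e"
      proof (intro exI allI impI)
        fix m n assume m: "m \<ge> M + 2 * r + 1" and n: "n > m"
        let ?v = "real m / real (r + 1)"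
        have v1: "?v \<ge> 1" using m by simp
        have "?v * dickman ?v \<le> 1"
          using dickman_mult_le[OF v1] dickman_le_1[of "?v - 1"] v1 by linarith
        hence "dickman ?v \<le> 1 / ?v" using v1 by (simp add: field_simps)
        hence "K / (real r)\<^sup>2 * dickman ?v \<le> K / (real r)\<^sup>2 * (1 / ?v)"
          using K(1) by (intro mult_left_mono) auto
        also have "\<dots> < e"
        proof -
          have "K / (real r)\<^sup>2 * real (r + 1) / e < real m" using M m by linarith
          hence "K / (real r)\<^sup>2 * real (r + 1) < e * real m"
            using e by (simp only: pos_divide_less_eq mult.commute[of e])
          moreover have "real m > 0" using m by simp
          ultimately have "K / (real r)\<^sup>2 * real (r + 1) / real m < e"
            by (simp only: pos_divide_less_eq)
          thus ?thesis by simp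
        qed
        finally have "K / (real r)\<^sup>2 * dickman ?v < e" .
        moreover have "\<bar>kappa_err r n - kappa_err r m\<bar> \<le> K / (real r)\<^sup>2 * dickman ?v"
          using K(3)[OF r, of m n] m n by simp
        ultimately show "dist (kappa_err r m) (kappa_err r n) < e" by (simp add: dist_real_def abs_minus_commute)
      qed
    qed
    thus ?thesis by (simp add: Cauchy_convergent_iff)
  qed
  let ?c = "\<lambda>r. exp (- harm r + euler_mascheroni) :: real"
  have buch: "buchstab (real n / real r) = (kappa n r - kappa_err r n) / ?c r" for n r
    by (simp add: kappa_err_def)
  \<comment> \<open>Taking \<open>r = 1\<close> makes every integer a grid point.\<close>
  obtain L where L: "(\<lambda>n. buchstab (real n)) \<longlonglongrightarrow> L"
  proof -
    obtain l where l: "kappa_err 1 \<longlonglongrightarrow> l" using conv[of 1] by (auto simp: convergent_def)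
    have "(\<lambda>n. (kappa n 1 - kappa_err 1 n) / ?c 1) \<longlonglongrightarrow> (exp (- harm 1) - l) / ?c 1"
      by (intro tendsto_intros l kappa_tendsto) auto
    hence "(\<lambda>n. buchstab (real n / real 1)) \<longlonglongrightarrow> (exp (- harm 1) - l) / ?c 1"
      unfolding buch .
    thus ?thesis using that by simp
  qed
  \<comment> \<open>Along multiples of \<open>r\<close> the arguments of \<open>buchstab\<close> are
    integers, so the same \<open>L\<close> appears for every \<open>r\<close>.\<close>
  have lim: "kappa_err r \<longlonglongrightarrow> ?c r * (exp (- euler_mascheroni) - L)" if r: "r \<ge> 1" for r
  proof -
    obtain l where l: "kappa_err r \<longlonglongrightarrow> l" using conv[OF r] by (auto simp: convergent_def)
    have sub: "strict_mono (\<lambda>k. r * k)" using r by (auto simp: strict_mono_def)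
    have "(\<lambda>k. kappa_err r (r * k)) \<longlonglongrightarrow> l"
      using LIMSEQ_subseq_LIMSEQ[OF l sub] by (simp add: o_def)
    moreover have "(\<lambda>k. kappa (r * k) r) \<longlonglongrightarrow> exp (- harm r)"
      using LIMSEQ_subseq_LIMSEQ[OF kappa_tendsto[OF r] sub] by (simp add: o_def)
    hence "(\<lambda>k. kappa (r * k) r - ?c r * buchstab (real k)) \<longlonglongrightarrow> exp (- harm r) - ?c r * L"
      by (intro tendsto_intros L)
    hence "(\<lambda>k. kappa_err r (r * k)) \<longlonglongrightarrow> exp (- harm r) - ?c r * L"
      using r by (simp add: kappa_err_def)
    ultimately have "l = exp (- harm r) - ?c r * L" by (rule LIMSEQ_unique)
    also have "exp (- harm r) = ?c r * exp (- euler_mascheroni)" by (simp flip: exp_add)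
    finally show ?thesis using l by (simp add: right_diff_distrib)
  qed
  have small: "\<bar>exp (- euler_mascheroni) - L\<bar> \<le> 4 * K / real r" if r: "r \<ge> 1" for r
  proof -
    have r0: "real r > 0" using r by simp
    have "\<bar>?c r * (exp (- euler_mascheroni) - L)\<bar> \<le> 2 * K / (real r)\<^sup>2"
    proof (rule LIMSEQ_le_const2)
      show "(\<lambda>n. \<bar>kappa_err r n\<bar>) \<longlonglongrightarrow> \<bar>?c r * (exp (- euler_mascheroni) - L)\<bar>"
        by (intro tendsto_intros lim r)
      have "\<bar>kappa_err r n\<bar> \<le> 2 * K / (real r)\<^sup>2" if "n \<ge> 2 * r + 1" for n
      proof -
        have "\<bar>kappa_err r n - kappa_err r (2 * r + 1)\<bar>
            \<le> K / (real r)\<^sup>2 * dickman (real (2 * r + 1) / real (r + 1))"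
          using K(3)[OF r, of "2 * r + 1" n] that by simp
        also have "\<dots> \<le> K / (real r)\<^sup>2 * 1"
          using K(1) by (intro mult_left_mono dickman_le_1) auto
        finally show ?thesis using K(2)[OF r] by simp
      qed
      thus "\<exists>N. \<forall>n\<ge>N. \<bar>kappa_err r n\<bar> \<le> 2 * K / (real r)\<^sup>2" by blast
    qed
    hence 1: "?c r * \<bar>exp (- euler_mascheroni) - L\<bar> \<le> 2 * K / (real r)\<^sup>2" by (simp add: abs_mult)
    have "1 / (2 * real r) \<le> 1 / real (r + 1)" using r by (intro divide_left_mono) auto
    hence "1 / (2 * real r) \<le> ?c r" using exp_euler_minus_harm_bounds(1)[OF r] by linarith
    hence "1 / (2 * real r) * \<bar>exp (- euler_mascheroni) - L\<bar> \<le> ?c r * \<bar>exp (- euler_mascheroni) - L\<bar>"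
      by (intro mult_right_mono) auto
    hence "1 / (2 * real r) * \<bar>exp (- euler_mascheroni) - L\<bar> \<le> 2 * K / (real r)\<^sup>2" using 1 by linarith
    thus ?thesis using r0 by (simp add: field_simps power2_eq_square)
  qed
  have "\<bar>exp (- euler_mascheroni) - L\<bar> \<le> 0"
  proof (rule LIMSEQ_le_const)
    show "(\<lambda>r. 4 * K / real r) \<longlonglongrightarrow> 0" by (rule lim_const_over_n)
    show "\<exists>N. \<forall>r\<ge>N. \<bar>exp (- euler_mascheroni) - L\<bar> \<le> 4 * K / real r" using small by blast
  qed
  thus ?thesis using lim[OF r] by simp
qed

section \<open>Passage from \<open>n / (r + 1)\<close> to \<open>n / r\<close>, and
  conclusion\<close>

text \<open>The arguments differ by at most \<open>n / r ^ 2\<close> and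
  \<open>dickman_ratio\<close> is at most \<open>6 * ln n\<close> there, so the logarithm changes by
  at most 6 because \<open>n * ln n \<le> r ^ 2\<close>.\<close>

lemma dickman_rescale_le:
  assumes r: "r \<ge> 1" "r < n" and h: "sqrt (real n * ln (real n)) \<le> real r"
  shows "dickman (real n / real (r + 1)) \<le> exp 6 * dickman (real n / real r)"
proof -
  let ?a = "real n / real (r + 1)" and ?b = "real n / real r"
  have r0: "real r \<ge> 1" using r by simp
  have n2: "real n \<ge> 2" using r by simp
  have a1: "?a \<ge> 1" using r by simp
  have ab: "?a \<le> ?b" using r0 by (intro divide_left_mono) auto
  have bn: "?b \<le> real n" using r0 n2 by (simp add: field_simps mult_left_le)
  have b1: "?b \<ge> 1" using a1 ab by linarith
  have "dickman_ratio ?b \<le> ln (4 * (?b + 1)\<^sup>2)" by (rule dickman_ratio_le_ln[OF b1])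
  also have "\<dots> \<le> ln (real n ^ 6)"
  proof -
    have "2 * (?b + 1) \<le> 4 * real n" using bn n2 by simp
    also have "4 * real n \<le> real n * real n * real n" 
      using mult_mono[of 2 "real n" 2 "real n"] n2 by (intro mult_right_mono) auto
    finally have "(2 * (?b + 1))\<^sup>2 \<le> (real n * real n * real n)\<^sup>2" using b1 by (intro power_mono) auto
    also have "\<dots> = real n ^ 6" by (simp add: power2_eq_square eval_nat_numeral mult_ac)
    also have "(2 * (?b + 1))\<^sup>2 = 4 * (?b + 1)\<^sup>2" unfolding power_mult_distrib by simp
    finally have "4 * (?b + 1)\<^sup>2 \<le> real n ^ 6" .
    thus ?thesis using b1 n2 by (subst ln_le_cancel_iff) auto
  qed
  also have "\<dots> = 6 * ln (real n)" using n2 by (simp add: ln_realpow)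
  finally have R: "dickman_ratio ?b \<le> 6 * ln (real n)" .
  have "real n * ln (real n) \<le> (real r)\<^sup>2"
    by (rule sqrt_le_D[OF h])
  hence nl: "real n * ln (real n) / (real r)\<^sup>2 \<le> 1" using r0 by simp
  have "?b - ?a \<le> real n / (real r)\<^sup>2"
  proof -
    have "?b - ?a = real n / (real r * real (r + 1))" using r0 by (simp add: field_simps)
    also have "\<dots> \<le> real n / (real r)\<^sup>2"
      using r0 by (intro divide_left_mono) (auto simp: power2_eq_square)
    finally show ?thesis .
  qed
  hence "(?b - ?a) * dickman_ratio ?b \<le> real n / (real r)\<^sup>2 * (6 * ln (real n))"
    using R ab dickman_ratio_ge_1[OF b1] by (intro mult_mono) auto
  also have "\<dots> = 6 * (real n * ln (real n) / (real r)\<^sup>2)" by simp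
  also have "\<dots> \<le> 6" using nl by simp
  finally have "exp ((?b - ?a) * dickman_ratio ?b) \<le> exp 6" by simp
  hence "exp ((?b - ?a) * dickman_ratio ?b) * dickman ?b \<le> exp 6 * dickman ?b"
    using dickman_pos[of ?b] b1 by (intro mult_right_mono) auto
  thus ?thesis using dickman_exp_bounds(2)[OF a1 ab] by linarith
qed

theorem theorem1:
  shows "\<exists>C::real. C > 0 \<and>
    (\<forall>(n::nat) (r::nat). n \<ge> 2 \<longrightarrow> sqrt (real n * ln (real n)) \<le> real r \<longrightarrow> r < n \<longrightarrow>
      \<bar>kappa n r - exp (- harm r + euler_mascheroni) * buchstab (real n / real r)\<bar>
        \<le> C * (dickman (real n / real r) / (real r)\<^sup>2))"
proof -
  obtain K where K: "K > 0" "\<And>r n N. r \<ge> 1 \<Longrightarrow> 2 * r + 1 \<le> n \<Longrightarrow> n \<le> N \<Longrightarrow>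
      \<bar>kappa_err r N - kappa_err r n\<bar> \<le> K / (real r)\<^sup>2 * dickman (real n / real (r + 1))"
    by (rule kappa_err_bounds) blast
  \<comment> \<open>The first constant serves \<open>n \<le> 2 * r\<close>, where
    \<open>dickman (n / r) \<ge> dickman 2\<close>; the second serves larger
    \<open>n\<close>.\<close>
  define C where "C = max (1 / dickman 2) (K * exp 6)"
  have d2: "dickman 2 > 0" by (rule dickman_pos) simp
  have C: "C > 0" "1 / dickman 2 \<le> C" "K * exp 6 \<le> C"
    using K(1) by (auto simp: C_def less_max_iff_disj)
  show ?thesis
  proof (intro exI[of _ C] conjI allI impI C(1))
    fix n r :: nat
    assume n: "n \<ge> 2" and h: "sqrt (real n * ln (real n)) \<le> real r" and rn: "r < n"
    have "0 < sqrt (real n * ln (real n))" using n by simp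
    hence r: "r \<ge> 1" using h by linarith
    have r0: "real r > 0" using r by simp
    have d: "dickman (real n / real r) > 0" by (intro dickman_pos) auto
    have "\<bar>kappa_err r n\<bar> \<le> C * (dickman (real n / real r) / (real r)\<^sup>2)"
    proof (cases "n \<le> 2 * r")
      case True
      have "dickman 2 \<le> dickman (real n / real r)"
        using True r0 by (intro dickman_antimono) (auto simp: field_simps)
      hence "1 / dickman 2 * dickman 2 \<le> C * dickman (real n / real r)"
        using C d2 by (intro mult_mono) auto
      hence "1 / (real r)\<^sup>2 \<le> C * dickman (real n / real r) / (real r)\<^sup>2"
        using d2 by (intro divide_right_mono) auto
      thus ?thesis using kappa_err_initial_bound[OF r rn True] by simp
    next
      case False
      \<comment> \<open>Letting \<open>N\<close> tend to infinity removes
        \<open>kappa_err r N\<close> from the difference bound.\<close>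
      have "\<bar>kappa_err r n\<bar> \<le> K / (real r)\<^sup>2 * dickman (real n / real (r + 1))"
      proof (rule LIMSEQ_le_const2)
        show "(\<lambda>N. \<bar>kappa_err r N - kappa_err r n\<bar>) \<longlonglongrightarrow> \<bar>kappa_err r n\<bar>"
          using tendsto_rabs[OF tendsto_diff[OF kappa_err_tendsto_0[OF r] tendsto_const[of "kappa_err r n"]]]
          by simp
        show "\<exists>M. \<forall>N\<ge>M. \<bar>kappa_err r N - kappa_err r n\<bar> \<le> K / (real r)\<^sup>2 * dickman (real n / real (r + 1))"
          using K(2)[OF r, of n] False by (intro exI[of _ n]) auto
      qed
      also have "\<dots> \<le> K / (real r)\<^sup>2 * (exp 6 * dickman (real n / real r))"
        using K(1) by (intro mult_left_mono dickman_rescale_le r rn h) auto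
      also have "\<dots> = K * exp 6 * (dickman (real n / real r) / (real r)\<^sup>2)" by simp
      also have "\<dots> \<le> C * (dickman (real n / real r) / (real r)\<^sup>2)"
        using C d by (intro mult_right_mono) auto
      finally show ?thesis .
    qed
    thus "\<bar>kappa n r - exp (- harm r + euler_mascheroni) * buchstab (real n / real r)\<bar>
        \<le> C * (dickman (real n / real r) / (real r)\<^sup>2)"
      unfolding kappa_err_def .
  qed
qed

end
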